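(* For ${\bf x}\in\Delta_{4,2}$ let $M^5_{\bf x}=\mu^{-1}({\bf x})\subset G_{4,2}$. The manifolds $M^5_{\bf x}$ and $M^5_{\bf y}$ are diffeomorphic for all ${\bf x},{\bf y}\in\Delta_{4,2}$ that belong to chambers of maximal dimension $3$.
   Context: $G_{4,2}$ is the Grassmannian of 2-dimensional complex subspaces of $\mathbb{C}^4$, with Plücker coordinates $P^{ij}(L)$. $\Lambda_{ij}=e_i+e_j\in\mathbb{R}^4$; $\Delta_{4,2}=\{x\in\mathbb{R}^4:0\le x_i\le1,\ \sum x_i=2\}$. The moment map of the canonical $T^4$-action is $\mu(L)=\big(\sum_{i<j}|P^{ij}(L)|^2\Lambda_{ij}\big)/\big(\sum_{i<j}|P^{ij}(L)|^2\big)$. The chambers of maximal dimension 3 in $\Delta_{4,2}$ are the 8 connected components of the interior of $\Delta_{4,2}$ minus the hyperplanes $x_1+x_i=1$, $i=2,3,4$; they are given by the possible choices of strict inequalities $x_1+x_i<1$ or $x_1+x_i>1$. For ${\bf x}$ in such a chamber, $\mu^{-1}({\bf x})$ is a smooth 5-dimensional submanifold of $G_{4,2}$. *)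

theory Defs
  imports "HOL-Analysis.Analysis"
begin

section \<open>The Grassmannian and the moment map\<close>

text \<open>Coordinates of \<open>\<complex>\<^sup>4\<close> and \<open>\<real>\<^sup>4\<close> are indexed by the type \<open>4\<close>, whose elements are \<open>1, 2, 3\<close> and
  \<open>4 = 0\<close>.  The constants \<open>vec.subspace\<close>, \<open>vec.dim\<close> and \<open>vec.span\<close> refer to the scalar field of the
  components, here \<open>\<complex>\<close>.\<close>

definition Gr42 :: "(complex^4) set set" where
  "Gr42 = {L. vec.subspace L \<and> vec.dim L = 2}"

definition is_frame :: "(complex^4) set \<Rightarrow> (complex^4) \<times> (complex^4) \<Rightarrow> bool" where
  "is_frame L = (\<lambda>(a, b). a \<noteq> b \<and> vec.independent {a, b} \<and> vec.span {a, b} = L)"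

definition minor :: "(complex^4) \<times> (complex^4) \<Rightarrow> 4 \<Rightarrow> 4 \<Rightarrow> complex" where
  "minor = (\<lambda>(a, b) i j. a $ i * b $ j - a $ j * b $ i)"

text \<open>Homogeneous coordinates are only determined up to a common nonzero factor; we fix a
  representative by choosing a basis of \<open>L\<close>.  The moment map does not depend on the choice, see
  \<open>moment_map_frame\<close> below.\<close>

definition plucker :: "4 \<Rightarrow> 4 \<Rightarrow> (complex^4) set \<Rightarrow> complex" where
  "plucker i j L = minor (SOME f. is_frame L f) i j"

definition Lambda :: "4 \<Rightarrow> 4 \<Rightarrow> real^4" where
  "Lambda i j = axis i 1 + axis j 1"

text \<open>The summands are symmetric in \<open>i\<close> and \<open>j\<close>, so it is immaterial that the order on the index
  type is \<open>0 < 1 < 2 < 3\<close> with \<open>0 = 4\<close>.\<close>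

definition moment_map :: "(complex^4) set \<Rightarrow> real^4" where
  "moment_map L =
     (\<Sum>(i, j)\<in>{(i, j). i < j}. (cmod (plucker i j L))\<^sup>2 *\<^sub>R Lambda i j) /\<^sub>R
     (\<Sum>(i, j)\<in>{(i, j). i < j}. (cmod (plucker i j L))\<^sup>2)"

definition moment_fibre :: "real^4 \<Rightarrow> (complex^4) set set" where
  "moment_fibre x = {L \<in> Gr42. moment_map L = x}"


section \<open>The hypersimplex and its chambers of maximal dimension\<close>

definition hypersimplex :: "(real^4) set" where
  "hypersimplex = {x. (\<forall>i. 0 \<le> x $ i \<and> x $ i \<le> 1) \<and> (\<Sum>i\<in>UNIV. x $ i) = 2}"

text \<open>The interior is taken relative to the hyperplane \<open>x\<^sub>1 + x\<^sub>2 + x\<^sub>3 + x\<^sub>4 = 2\<close>.\<close>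

definition max_chambers :: "(real^4) set set" where
  "max_chambers =
     components (rel_interior hypersimplex - (\<Union>i\<in>{2, 3, 4}. {x. x $ 1 + x $ i = 1}))"


section \<open>Smooth maps on the Grassmannian\<close>

text \<open>\<open>C\<^sup>k\<close> and \<open>C\<^sup>\<infinity>\<close> maps on an open set, in the real sense.\<close>

primrec Ck_on :: "nat \<Rightarrow> 'a::real_normed_vector set \<Rightarrow> ('a \<Rightarrow> 'b::real_normed_vector) \<Rightarrow> bool" where
  "Ck_on 0 S f \<longleftrightarrow> continuous_on S f"
| "Ck_on (Suc k) S f \<longleftrightarrow>
     (\<forall>x\<in>S. f differentiable (at x)) \<and> (\<forall>v. Ck_on k S (\<lambda>x. frechet_derivative f (at x) v))"

definition smooth_on :: "'a::real_normed_vector set \<Rightarrow> ('a \<Rightarrow> 'b::real_normed_vector) \<Rightarrow> bool" where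
  "smooth_on S f \<longleftrightarrow> (\<forall>k. Ck_on k S f)"

text \<open>The standard affine charts, given by their inverse parametrizations: for a permutation
  \<open>\<sigma>\<close> of the indices, the planes that are graphs of linear maps from the coordinate plane
  \<open>(\<sigma> 1, \<sigma> 2)\<close> to the coordinate plane \<open>(\<sigma> 3, \<sigma> 4)\<close>, that is, the planes with
  \<open>plucker (\<sigma> 1) (\<sigma> 2) L \<noteq> 0\<close>.  The four entries of \<open>z\<close> are the matrix of the linear map.\<close>

definition graph_frame :: "(4 \<Rightarrow> 4) \<Rightarrow> complex^4 \<Rightarrow> (complex^4) \<times> (complex^4)" where
  "graph_frame \<sigma> z =
     (axis (\<sigma> 1) 1 + axis (\<sigma> 3) (z $ 1) + axis (\<sigma> 4) (z $ 2),
      axis (\<sigma> 2) 1 + axis (\<sigma> 3) (z $ 3) + axis (\<sigma> 4) (z $ 4))"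

definition param :: "(4 \<Rightarrow> 4) \<Rightarrow> complex^4 \<Rightarrow> (complex^4) set" where
  "param \<sigma> z = (case graph_frame \<sigma> z of (a, b) \<Rightarrow> vec.span {a, b})"

definition chart :: "(4 \<Rightarrow> 4) \<Rightarrow> (complex^4) set \<Rightarrow> complex^4" where
  "chart \<sigma> = inv (param \<sigma>)"

definition open_Gr :: "(complex^4) set set \<Rightarrow> bool" where
  "open_Gr W \<longleftrightarrow> W \<subseteq> Gr42 \<and> (\<forall>\<sigma>. bij \<sigma> \<longrightarrow> open (param \<sigma> -` W))"

text \<open>Smoothness in all pairs of charts; openness of the domains of the coordinate
  representations is continuity of \<open>F\<close>.\<close>

definition smooth_Gr_on :: "(complex^4) set set \<Rightarrow> ((complex^4) set \<Rightarrow> (complex^4) set) \<Rightarrow> bool" where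
  "smooth_Gr_on W F \<longleftrightarrow> open_Gr W \<and> F ` W \<subseteq> Gr42 \<and>
     (\<forall>\<sigma> \<tau>. bij \<sigma> \<longrightarrow> bij \<tau> \<longrightarrow>
        (let V = {z. param \<sigma> z \<in> W \<and> F (param \<sigma> z) \<in> range (param \<tau>)}
         in open V \<and> smooth_on V (\<lambda>z. chart \<tau> (F (param \<sigma> z)))))"

text \<open>For embedded submanifolds, a map is smooth iff it is locally the restriction of a smooth map
  of the ambient manifold.\<close>

definition smooth_map :: "(complex^4) set set \<Rightarrow> (complex^4) set set \<Rightarrow>
    ((complex^4) set \<Rightarrow> (complex^4) set) \<Rightarrow> bool" where
  "smooth_map M N f \<longleftrightarrow> f ` M \<subseteq> N \<and>
     (\<forall>p\<in>M. \<exists>W F. p \<in> W \<and> smooth_Gr_on W F \<and> (\<forall>q\<in>M \<inter> W. F q = f q))"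

definition diffeomorphic :: "(complex^4) set set \<Rightarrow> (complex^4) set set \<Rightarrow> bool" where
  "diffeomorphic M N \<longleftrightarrow>
     (\<exists>f g. smooth_map M N f \<and> smooth_map N M g \<and> (\<forall>p\<in>M. g (f p) = p) \<and> (\<forall>q\<in>N. f (g q) = q))"


section \<open>Well-definedness\<close>

lemma sum_less_4:
  fixes h :: "4 \<Rightarrow> 4 \<Rightarrow> 'a::comm_monoid_add"
  assumes "\<And>i j. h i j = h j i"
  shows "(\<Sum>(i, j)\<in>{(i, j). i < j}. h i j) = h 1 2 + h 1 3 + h 1 4 + h 2 3 + h 2 4 + h 3 4"
proof -
  have lt: "(4::4) < 1" "(4::4) < 2" "(4::4) < 3" "(1::4) < 2" "(1::4) < 3" "(2::4) < 3"
    by (simp_all add: less_bit0_def bit0.Rep_1 bit0.Rep_numeral)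
  have "\<forall>i j :: 4. i < j \<longleftrightarrow> (i, j) \<in> {(1,2), (1,3), (4,1), (2,3), (4,2), (4,3)}"
    unfolding forall_4 using lt by (simp add: less_imp_not_less)
  then have e: "{(i, j). i < j} = {(1,2), (1,3), (4,1), (2,3), (4,2), (4,3::4)}"
    by blast
  show ?thesis
    unfolding e by (simp add: assms[of 4 _] ac_simps)
qed

lemma is_frame_exists:
  assumes "L \<in> Gr42" shows "\<exists>f. is_frame L f"
proof -
  from assms have L: "vec.subspace L" "vec.dim L = 2" by (auto simp: Gr42_def)
  obtain B where B: "B \<subseteq> L" "vec.independent B" "L \<subseteq> vec.span B" "card B = vec.dim L"
    using vec.basis_exists by blast
  then obtain a b where "B = {a, b}" "a \<noteq> b" using L by (auto simp: card_2_iff)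
  moreover have "vec.span B = L" using B L vec.span_minimal by blast
  ultimately show ?thesis using B by (auto simp: is_frame_def)
qed

lemma span_pairD:
  assumes "v \<in> vec.span {a, b :: complex^4}"
  obtains s t where "v = s *s a + t *s b"
proof -
  from assms obtain s where "v - s *s a \<in> vec.span {b}"
    by (auto simp: vec.span_insert)
  then obtain t where "v - s *s a = t *s b" by (auto simp: vec.span_singleton)
  then show ?thesis using that[of s t] by (metis add.commute diff_add_cancel)
qed

lemma minor_change_of_frame:
  assumes "is_frame L f" "is_frame L g"
  obtains c where "c \<noteq> 0" "\<And>i j. minor g i j = c * minor f i j"
proof -
  obtain a b a' b' where fg: "f = (a, b)" "g = (a', b')" by force
  have F: "a \<noteq> b" "vec.independent {a, b}" "vec.span {a, b} = L"
    and G: "a' \<noteq> b'" "vec.independent {a', b'}" "vec.span {a', b'} = L"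
    using assms by (auto simp: is_frame_def fg)
  have "a' \<in> vec.span {a, b}" "b' \<in> vec.span {a, b}"
    unfolding F(3) G(3)[symmetric] by (simp_all add: vec.span_base)
  then obtain p q r s where a': "a' = p *s a + q *s b" and b': "b' = r *s a + s *s b"
    by (metis span_pairD)
  have "p * s - q * r \<noteq> 0"
  proof
    assume z: "p * s - q * r = 0"
    have "s *s a' - q *s b' = (p * s - q * r) *s a" "p *s b' - r *s a' = (p * s - q * r) *s b"
      unfolding a' b' by (simp_all add: vec_eq_iff algebra_simps)
    then have d: "s *s a' + (- q) *s b' = 0" "(- r) *s a' + p *s b' = 0"
      by (simp_all add: z algebra_simps)
    have i: "u = 0 \<and> v = 0" if "u *s a' + v *s b' = 0" for u v
    proof -
      have *: "(if w = a' then u else v) = 0" if "w \<in> {a', b'}" for w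
        using vec.independentD[OF G(2), of "{a', b'}" "\<lambda>x. if x = a' then u else v" w]
          that \<open>u *s a' + v *s b' = 0\<close> G(1) by simp
      show ?thesis using *[of a'] *[of b'] G(1) by simp
    qed
    have "s = 0 \<and> - q = 0" "- r = 0 \<and> p = 0"
      using d[THEN i] by blast+
    then have "a' = 0" by (simp add: a')
    then show False using G(2) vec.dependent_zero by blast
  qed
  moreover have "minor g i j = (p * s - q * r) * minor f i j" for i j
    by (simp add: fg minor_def a' b' algebra_simps)
  ultimately show ?thesis using that by blast
qed

lemma moment_map_frame:
  assumes "is_frame L f"
  shows "moment_map L =
     (\<Sum>(i, j)\<in>{(i, j). i < j}. (cmod (minor f i j))\<^sup>2 *\<^sub>R Lambda i j) /\<^sub>R
     (\<Sum>(i, j)\<in>{(i, j). i < j}. (cmod (minor f i j))\<^sup>2)"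
proof -
  have "is_frame L (SOME g. is_frame L g)" using assms by (rule someI)
  from minor_change_of_frame[OF assms this] obtain c where c: "c \<noteq> 0"
    "\<And>i j. plucker i j L = c * minor f i j" by (metis plucker_def)
  have 1: "(\<Sum>(i, j)\<in>{(i, j). i < j}. (cmod (plucker i j L))\<^sup>2) =
    (cmod c)\<^sup>2 * (\<Sum>(i, j)\<in>{(i, j). i < j}. (cmod (minor f i j))\<^sup>2)"
    by (simp add: c norm_mult power_mult_distrib sum_distrib_left case_prod_unfold)
  have 2: "(\<Sum>(i, j)\<in>{(i, j). i < j}. (cmod (plucker i j L))\<^sup>2 *\<^sub>R Lambda i j) =
    (cmod c)\<^sup>2 *\<^sub>R (\<Sum>(i, j)\<in>{(i, j). i < j}. (cmod (minor f i j))\<^sup>2 *\<^sub>R Lambda i j)"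
    by (simp add: c norm_mult power_mult_distrib scaleR_sum_right case_prod_unfold)
  show ?thesis unfolding moment_map_def 1 2 using c(1) by simp
qed

lemma is_frame_graph_frame:
  assumes "bij \<sigma>" shows "is_frame (param \<sigma> z) (graph_frame \<sigma> z)"
proof -
  obtain a b where ab: "graph_frame \<sigma> z = (a, b)" by force
  have d: "\<sigma> 1 \<noteq> \<sigma> 2" "\<sigma> 1 \<noteq> \<sigma> 3" "\<sigma> 1 \<noteq> \<sigma> 4" "\<sigma> 2 \<noteq> \<sigma> 3" "\<sigma> 2 \<noteq> \<sigma> 4"
    using assms by (auto simp: bij_def inj_eq)
  have c: "a $ \<sigma> 1 = 1" "a $ \<sigma> 2 = 0" "b $ \<sigma> 1 = 0" "b $ \<sigma> 2 = 1"
    using ab d by (auto simp: graph_frame_def axis_def)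
  have "a \<noteq> b" using c by auto
  moreover have "vec.independent {a, b}"
  proof -
    have "b \<noteq> 0" using c by auto
    moreover have "a \<noteq> k *s b" for k
    proof
      assume "a = k *s b"
      then have "a $ \<sigma> 1 = k * b $ \<sigma> 1" by simp
      with c show False by simp
    qed
    ultimately show ?thesis
      by (auto simp: vec.independent_insert vec.span_singleton vec.dependent_single)
  qed
  ultimately show ?thesis by (simp add: is_frame_def param_def ab)
qed

lemma is_frame_Gr42: "is_frame L f \<Longrightarrow> L \<in> Gr42"
  by (auto simp: is_frame_def Gr42_def vec.subspace_span vec.dim_eq_card_independent)

lemma param_in_Gr42: "bij \<sigma> \<Longrightarrow> param \<sigma> z \<in> Gr42"
  using is_frame_graph_frame is_frame_Gr42 by blast

lemma inj_param:
  assumes "bij \<sigma>" shows "inj (param \<sigma>)"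
proof (rule injI)
  fix z w assume eq: "param \<sigma> z = param \<sigma> w"
  have d: "distinct [\<sigma> 1, \<sigma> 2, \<sigma> 3, \<sigma> 4]"
    using assms by (auto simp: bij_def inj_eq)
  obtain a b a' b' where ab: "graph_frame \<sigma> z = (a, b)" "graph_frame \<sigma> w = (a', b')" by force
  have c: "a $ \<sigma> 1 = 1" "a $ \<sigma> 2 = 0" "b $ \<sigma> 1 = 0" "b $ \<sigma> 2 = 1"
     "a $ \<sigma> 3 = z $ 1" "a $ \<sigma> 4 = z $ 2" "b $ \<sigma> 3 = z $ 3" "b $ \<sigma> 4 = z $ 4"
     "a' $ \<sigma> 1 = 1" "a' $ \<sigma> 2 = 0" "b' $ \<sigma> 1 = 0" "b' $ \<sigma> 2 = 1"
     "a' $ \<sigma> 3 = w $ 1" "a' $ \<sigma> 4 = w $ 2" "b' $ \<sigma> 3 = w $ 3" "b' $ \<sigma> 4 = w $ 4"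
    using ab d by (auto simp: graph_frame_def axis_def)
  have "vec.span {a, b} = vec.span {a', b'}" using eq by (simp add: param_def ab)
  then have "a' \<in> vec.span {a, b}" "b' \<in> vec.span {a, b}" by (auto simp: vec.span_base)
  then obtain p q r s where e: "a' = p *s a + q *s b" "b' = r *s a + s *s b"
    by (metis span_pairD)
  have "a' $ \<sigma> 1 = p" "a' $ \<sigma> 2 = q" "b' $ \<sigma> 1 = r" "b' $ \<sigma> 2 = s"
    unfolding e using c by simp_all
  then have "a' = a" "b' = b" using c e by simp_all
  then have "w $ 1 = z $ 1" "w $ 2 = z $ 2" "w $ 3 = z $ 3" "w $ 4 = z $ 4"
    by (simp_all only: c(5-8, 13-16)[symmetric])
  then show "z = w" unfolding vec_eq_iff forall_4 by simp
qed

lemma param_cover: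
  assumes "L \<in> Gr42" obtains \<sigma> where "bij \<sigma>" "L \<in> range (param \<sigma>)"
proof -
  obtain a b where F: "is_frame L (a, b)" using is_frame_exists[OF assms] by force
  then have ind: "a \<noteq> b" "vec.independent {a, b}" and L: "L = vec.span {a, b}"
    by (auto simp: is_frame_def)
  have "a \<noteq> 0" using ind(2) vec.dependent_zero by blast
  then obtain i where i: "a $ i \<noteq> 0" by (auto simp: vec_eq_iff)
  have "\<exists>j. minor (a, b) i j \<noteq> 0"
  proof (rule ccontr)
    assume "\<not> ?thesis"
    then have eq: "(b $ i / a $ i) *s a = b"
      using i by (simp add: vec_eq_iff minor_def nonzero_divide_eq_eq mult.commute)
    have "a \<in> vec.span ({a, b} - {b})" using ind(1) by (simp add: vec.span_base)
    then have "(b $ i / a $ i) *s a \<in> vec.span ({a, b} - {b})" by (rule vec.span_scale)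
    then have "b \<in> vec.span ({a, b} - {b})" unfolding eq .
    then show False using ind(2) vec.dependent_def by blast
  qed
  then obtain j where j: "minor (a, b) i j \<noteq> 0" by blast
  define d where "d = minor (a, b) i j"
  have "i \<noteq> j" using j by (auto simp: minor_def)
  define t where "t = Transposition.transpose 1 i"
  define \<sigma> where "\<sigma> = Transposition.transpose (t 2) j \<circ> t"
  have n21: "(2::4) \<noteq> 1" by simp
  have t: "bij t" "t 1 = i" by (auto simp: t_def)
  then have "t 2 \<noteq> i" by (metis (full_types) bij_def inj_eq n21)
  then have \<sigma>: "bij \<sigma>" "\<sigma> 1 = i" "\<sigma> 2 = j"
    using \<open>i \<noteq> j\<close> t by (auto simp: \<sigma>_def bij_comp Transposition.transpose_def)
  define a' b' where "a' = (b $ j / d) *s a + (- a $ j / d) *s b"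
    and "b' = (- b $ i / d) *s a + (a $ i / d) *s b"
  have c: "a' $ i = 1" "a' $ j = 0" "b' $ i = 0" "b' $ j = 1"
    using j by (auto simp: a'_def b'_def d_def minor_def divide_simps)
  define z :: "complex^4" where "z = (\<chi> k. if k = 1 then a' $ \<sigma> 3 else if k = 2 then a' $ \<sigma> 4
    else if k = 3 then b' $ \<sigma> 3 else b' $ \<sigma> 4)"
  have dist: "distinct [\<sigma> 1, \<sigma> 2, \<sigma> 3, \<sigma> 4]"
    using \<sigma>(1) by (auto simp: bij_def inj_eq)
  have all: "(\<forall>k. P k) \<longleftrightarrow> P (\<sigma> 1) \<and> P (\<sigma> 2) \<and> P (\<sigma> 3) \<and> P (\<sigma> 4)" for P
  proof -
    have "(\<forall>k. P k) \<longleftrightarrow> (\<forall>k. P (\<sigma> k))" using \<sigma>(1) by (metis bij_pointE)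
    then show ?thesis by (simp only: forall_4)
  qed
  have gf: "graph_frame \<sigma> z = (a', b')"
    unfolding graph_frame_def prod.inject vec_eq_iff all
    using dist c \<sigma> by (auto simp: axis_def z_def)
  have "a' \<in> L" "b' \<in> L"
    unfolding L a'_def b'_def by (intro vec.span_add vec.span_scale vec.span_base; simp)+
  then have "param \<sigma> z \<subseteq> L"
    by (simp add: param_def gf vec.span_minimal L vec.subspace_span)
  moreover have "vec.subspace (param \<sigma> z)" "vec.dim (param \<sigma> z) = 2"
    "vec.subspace L" "vec.dim L = 2"
    using param_in_Gr42[OF \<sigma>(1), of z] assms by (auto simp: Gr42_def)
  ultimately have "param \<sigma> z = L"
    by (metis order_refl vec.subspace_dim_equal)
  then show ?thesis using that \<sigma>(1) by blast
qed

end

theory Submission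
  imports Defs
begin

text \<open>
  The fibres over two points of one chamber meet the same orbits of the positive real torus
  \<open>(\<real>\<^sub>>\<^sub>0)\<^sup>4\<close>, each of these orbits in exactly one point, so following the orbits identifies the two
  fibres. The eight chambers are all equivalent under permutations of the coordinates and under passing
  from a plane to its annihilator, which replaces \<open>x\<close> by \<open>1 - x\<close>: in each chamber there is either an index
  \<open>k\<close> with \<open>x\<^sub>k + x\<^sub>j < 1\<close> for all \<open>j \<noteq> k\<close>, or one with \<open>x\<^sub>k + x\<^sub>j > 1\<close> for all \<open>j \<noteq> k\<close>
  (\<open>light_or_heavy_index\<close>). Everything can be done explicitly, because such a fibre lies in a single
  affine chart (\<open>moment_fibre_in_chart\<close>); both kinds of symmetries amount to a choice of this chart
  and a linear change of its coordinates (\<open>moment_fibre_normal_form\<close>).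

  Assume that the index \<open>k = 3\<close> is light. The moment map fixes the differences of the normalized
  \<open>|P\<^sup>i\<^sup>j|\<^sup>2\<close> for complementary pairs of indices, and along an orbit of the torus the products
  \<open>|P\<^sup>i\<^sup>j P\<^sup>k\<^sup>l|\<^sup>2\<close> for the three partitions of the indices into pairs are fixed up to one common
  factor \<open>r\<close>. So the squared moduli of all Pluecker coordinates of the point that is sought are roots of quadratic
  equations, and \<open>r\<close> is determined by the condition that the normalized squares add up to \<open>1\<close>. This
  condition is strictly monotone in \<open>r\<close>, so it has a unique solution, and the implicit function theorem
  (\<open>smooth_on_implicit\<close>) shows that it depends smoothly on the orbit. The result is for each admissible
  \<open>a\<close> a smooth map \<open>orbit_proj a\<close> from an open set of stable points, which is the same for all \<open>a\<close>,
  to the fibre over \<open>a\<close>. It is constant on orbits (\<open>orbit_proj_invariant\<close>) and the identity on the fibre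
  over \<open>a\<close> (\<open>orbit_proj_fixes\<close>). Hence \<open>orbit_proj a\<close> and \<open>orbit_proj b\<close> are inverse to each other
  between the fibres over \<open>b\<close> and over \<open>a\<close>.
\<close>


section \<open>Maps of class \<open>C\<^sup>k\<close> and smooth maps on open sets\<close>

lemma frechet_derivativeI:
  "(f has_derivative f') (at x) \<Longrightarrow> frechet_derivative f (at x) = f'"
  using frechet_derivative_at by metis

lemma Ck_on_SucI:
  assumes "\<And>x. x \<in> S \<Longrightarrow> (f has_derivative f' x) (at x)"
    and "\<And>v. Ck_on k S (\<lambda>x. frechet_derivative f (at x) v)"
  shows "Ck_on (Suc k) S f"
  using assms by (auto simp: differentiable_def)

lemma Ck_on_has_derivative:
  assumes "Ck_on (Suc k) S f" "x \<in> S"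
  shows "(f has_derivative frechet_derivative f (at x)) (at x)"
  using assms by (simp add: frechet_derivative_works)

lemma Ck_on_subset: "Ck_on k S f \<Longrightarrow> T \<subseteq> S \<Longrightarrow> Ck_on k T f"
  by (induction k arbitrary: f) (auto intro: continuous_on_subset)

lemma Ck_on_cong:
  assumes "open S" "\<And>x. x \<in> S \<Longrightarrow> f x = g x" "Ck_on k S f"
  shows "Ck_on k S g"
  using assms(2,3)
proof (induction k arbitrary: f g)
  case 0
  then show ?case by (auto cong: continuous_on_cong)
next
  case (Suc k)
  have d: "(g has_derivative frechet_derivative f (at x)) (at x)" if "x \<in> S" for x
    using has_derivative_transform_within_open[OF Ck_on_has_derivative[OF Suc.prems(2) that]
      assms(1) that] Suc.prems(1) by blast
  have "Ck_on k S (\<lambda>x. frechet_derivative g (at x) v)" for v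
    by (rule Suc.IH[of "\<lambda>x. frechet_derivative f (at x) v"])
      (use Suc.prems in \<open>auto simp: frechet_derivativeI[OF d]\<close>)
  with d show ?case by (rule Ck_on_SucI)
qed

text \<open>Outside of \<open>S\<close> nothing is known about \<open>f\<close>, so the derivative that the definition mentions agrees
  with a given formula only on \<open>S\<close>; openness of \<open>S\<close> makes this enough.\<close>

lemma Ck_on_Suc_derivI:
  assumes "open S" "\<And>x. x \<in> S \<Longrightarrow> (f has_derivative f' x) (at x)"
    and "\<And>v. Ck_on k S (\<lambda>x. f' x v)"
  shows "Ck_on (Suc k) S f"
proof (rule Ck_on_SucI[OF assms(2)])
  fix v show "Ck_on k S (\<lambda>x. frechet_derivative f (at x) v)"
    by (rule Ck_on_cong[OF assms(1) _ assms(3)[of v]]) (simp add: frechet_derivativeI[OF assms(2)])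
qed

lemma Ck_on_imp_continuous_on:
  assumes "Ck_on k S f"
  shows "continuous_on S f"
proof (cases k)
  case 0
  then show ?thesis using assms by simp
next
  case (Suc j)
  have "isCont f x" if "x \<in> S" for x
    using assms that unfolding Suc Ck_on.simps by (blast intro: differentiable_imp_continuous_within)
  then show ?thesis by (intro continuous_at_imp_continuous_on) blast
qed

lemma Ck_on_SucD: "Ck_on (Suc k) S f \<Longrightarrow> Ck_on k S f"
proof (induction k arbitrary: f)
  case 0
  then show ?case unfolding Ck_on.simps(1) by (rule Ck_on_imp_continuous_on)
next
  case (Suc k)
  have "Ck_on k S (\<lambda>x. frechet_derivative f (at x) v)" for v
    by (rule Suc.IH) (use Suc.prems in simp)
  then show ?case using Suc.prems by simp
qed

lemma Ck_on_const: "Ck_on k S (\<lambda>x. c)"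
  by (induction k arbitrary: c) auto

lemma Ck_on_add:
  assumes "open S" "Ck_on k S f" "Ck_on k S g"
  shows "Ck_on k S (\<lambda>x. f x + g x)"
  using assms(2,3)
proof (induction k arbitrary: f g)
  case 0 then show ?case unfolding Ck_on.simps by (rule continuous_on_add)
next
  case (Suc k)
  have d: "((\<lambda>x. f x + g x) has_derivative
      (\<lambda>v. frechet_derivative f (at x) v + frechet_derivative g (at x) v)) (at x)"
    if "x \<in> S" for x
    by (rule has_derivative_add[OF Ck_on_has_derivative[OF Suc.prems(1) that]
        Ck_on_has_derivative[OF Suc.prems(2) that]])
  have "Ck_on k S (\<lambda>x. frechet_derivative f (at x) v + frechet_derivative g (at x) v)" for v
    by (rule Suc.IH) (use Suc.prems in simp_all)
  with d show ?case by (rule Ck_on_Suc_derivI[OF assms(1)])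
qed

lemma Ck_on_bilinear:
  assumes "open S" "bounded_bilinear prd" "Ck_on k S f" "Ck_on k S g"
  shows "Ck_on k S (\<lambda>x. prd (f x) (g x))"
  using assms(3,4)
proof (induction k arbitrary: f g)
  case 0 then show ?case unfolding Ck_on.simps by (rule bounded_bilinear.continuous_on[OF assms(2)])
next
  case (Suc k)
  have d: "((\<lambda>x. prd (f x) (g x)) has_derivative
      (\<lambda>v. prd (f x) (frechet_derivative g (at x) v) + prd (frechet_derivative f (at x) v) (g x))) (at x)"
    if "x \<in> S" for x
    by (rule bounded_bilinear.FDERIV[OF assms(2) Ck_on_has_derivative[OF Suc.prems(1) that]
        Ck_on_has_derivative[OF Suc.prems(2) that]])
  have "Ck_on k S (\<lambda>x. frechet_derivative f (at x) v)"
    "Ck_on k S (\<lambda>x. frechet_derivative g (at x) v)" for v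
    using Suc.prems by simp_all
  then have "Ck_on k S (\<lambda>x. prd (f x) (frechet_derivative g (at x) v)
      + prd (frechet_derivative f (at x) v) (g x))" for v
    by (intro Ck_on_add[OF assms(1)] Suc.IH Suc.prems[THEN Ck_on_SucD])
  with d show ?case by (rule Ck_on_Suc_derivI[OF assms(1)])
qed

lemma Ck_on_linear:
  assumes "open S" "bounded_linear h" "Ck_on k S f"
  shows "Ck_on k S (\<lambda>x. h (f x))"
  using assms(3)
proof (induction k arbitrary: f)
  case 0 then show ?case unfolding Ck_on.simps by (rule bounded_linear.continuous_on[OF assms(2)])
next
  case (Suc k)
  have d: "((\<lambda>x. h (f x)) has_derivative (\<lambda>v. h (frechet_derivative f (at x) v))) (at x)"
    if "x \<in> S" for x
    by (rule bounded_linear.has_derivative[OF assms(2) Ck_on_has_derivative[OF Suc.prems that]])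
  have "Ck_on k S (\<lambda>x. h (frechet_derivative f (at x) v))" for v
    by (rule Suc.IH) (use Suc.prems in simp)
  with d show ?case by (rule Ck_on_Suc_derivI[OF assms(1)])
qed

lemma Ck_on_id: "Ck_on k S (\<lambda>x. x)"
proof (cases k)
  case (Suc j)
  have "Ck_on j S (\<lambda>x. frechet_derivative (\<lambda>x. x) (at x) v)" for v :: 'a
    using Ck_on_const[of j S v] by simp
  then show ?thesis unfolding Suc by simp
qed simp

lemma Ck_on_sum:
  assumes "open S" "\<And>i. i \<in> I \<Longrightarrow> Ck_on k S (f i)"
  shows "Ck_on k S (\<lambda>x. \<Sum>i\<in>I. f i x)"
  using assms(2)
  by (induction I rule: infinite_finite_induct) (auto intro: Ck_on_const Ck_on_add[OF assms(1)])

text \<open>The derivative of the inner map enters the derivative of the outer one as a vector that varies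
  with the point, while \<^const>\<open>Ck_on\<close> speaks of directional derivatives in constant directions only.
  Expanding that vector in an orthonormal basis reduces the chain rule to the product rule; this is
  where the middle space has to be Euclidean.\<close>

lemma Ck_on_compose:
  fixes g :: "'b::euclidean_space \<Rightarrow> 'c::real_normed_vector"
  assumes "open S" "open T" "f ` S \<subseteq> T" "Ck_on k S f" "Ck_on k T g"
  shows "Ck_on k S (\<lambda>x. g (f x))"
  using assms(4,5)
proof (induction k arbitrary: g)
  case 0 then show ?case unfolding Ck_on.simps using continuous_on_compose2[OF _ _ assms(3), of g] by blast
next
  case (Suc k)
  let ?f = "\<lambda>x. frechet_derivative f (at x)" and ?g = "\<lambda>x. frechet_derivative g (at x)"
  have d: "((\<lambda>x. g (f x)) has_derivative (\<lambda>v. ?g (f x) (?f x v))) (at x)" if "x \<in> S" for x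
    using has_derivative_compose[OF Ck_on_has_derivative[OF Suc.prems(1) that]
      Ck_on_has_derivative[OF Suc.prems(2), of "f x"]] assms(3) that by blast
  have e: "(\<Sum>b\<in>Basis. (?f x v \<bullet> b) *\<^sub>R ?g (f x) b) = ?g (f x) (?f x v)" if "x \<in> S" for x v
  proof -
    have "linear (?g (f x))"
      using Ck_on_has_derivative[OF Suc.prems(2), of "f x"] assms(3) that
        has_derivative_linear by blast
    then have "?g (f x) (\<Sum>b\<in>Basis. (?f x v \<bullet> b) *\<^sub>R b) = (\<Sum>b\<in>Basis. (?f x v \<bullet> b) *\<^sub>R ?g (f x) b)"
      by (simp add: linear_sum linear_scale)
    then show ?thesis by (simp add: euclidean_representation)
  qed
  have "Ck_on k S (\<lambda>x. \<Sum>b\<in>Basis. (?f x v \<bullet> b) *\<^sub>R ?g (f x) b)" for v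
  proof (intro Ck_on_sum assms(1) Ck_on_bilinear[OF assms(1) bounded_bilinear_scaleR])
    fix b
    show "Ck_on k S (\<lambda>x. ?f x v \<bullet> b)"
      by (rule Ck_on_linear[OF assms(1) bounded_linear_inner_left]) (use Suc.prems in simp)
    show "Ck_on k S (\<lambda>x. ?g (f x) b)"
      using Suc.IH[of "\<lambda>y. ?g y b"] Suc.prems(1)[THEN Ck_on_SucD] Suc.prems(2) by simp
  qed
  then have "Ck_on k S (\<lambda>x. ?g (f x) (?f x v))" for v
    by (rule Ck_on_cong[OF assms(1) e, rotated]) simp
  with d show ?case by (rule Ck_on_Suc_derivI[OF assms(1)])
qed

text \<open>Here and for the square root the derivative is a product of known functions with the function
  itself, so one more order of differentiability is gained in each step of the induction.\<close>

lemma Ck_on_inverse: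
  fixes f :: "'a::real_normed_vector \<Rightarrow> 'b::real_normed_field"
  assumes "open S" "\<And>x. x \<in> S \<Longrightarrow> f x \<noteq> 0" "Ck_on k S f"
  shows "Ck_on k S (\<lambda>x. inverse (f x))"
  using assms(3)
proof (induction k)
  case 0 then show ?case using assms(2) by (auto intro!: continuous_on_inverse)
next
  case (Suc k)
  have m: "Ck_on k S (\<lambda>x. p x * q x)" if "Ck_on k S p" "Ck_on k S q" for p q :: "'a \<Rightarrow> 'b"
    by (rule Ck_on_bilinear[OF assms(1) bounded_bilinear_mult that])
  have i: "Ck_on k S (\<lambda>x. inverse (f x))" by (rule Suc.IH[OF Ck_on_SucD[OF Suc.prems]])
  have "Ck_on k S (\<lambda>x. - (inverse (f x) * frechet_derivative f (at x) v * inverse (f x)))" for v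
    by (intro Ck_on_linear[OF assms(1) bounded_linear_minus[OF bounded_linear_ident]] m i)
      (use Suc.prems in simp)
  with Deriv.has_derivative_inverse[OF assms(2) Suc.prems[THEN Ck_on_has_derivative]] show ?case
    by (rule Ck_on_Suc_derivI[OF assms(1)])
qed

lemma Ck_on_sqrt:
  assumes "open S" "\<And>x. x \<in> S \<Longrightarrow> f x > 0" "Ck_on k S f"
  shows "Ck_on k S (\<lambda>x. sqrt (f x))"
  using assms(3)
proof (induction k)
  case 0 then show ?case by (simp add: continuous_on_real_sqrt)
next
  case (Suc k)
  have m: "Ck_on k S (\<lambda>x. p x * q x)" if "Ck_on k S p" "Ck_on k S q" for p q :: "'a \<Rightarrow> real"
    by (rule Ck_on_bilinear[OF assms(1) bounded_bilinear_mult that])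
  have i: "Ck_on k S (\<lambda>x. sqrt (f x))" by (rule Suc.IH[OF Ck_on_SucD[OF Suc.prems]])
  have d: "((\<lambda>x. sqrt (f x)) has_derivative
      (\<lambda>v. frechet_derivative f (at x) v * inverse (2 * sqrt (f x)))) (at x)" if "x \<in> S" for x
    using assms(2)[OF that]
    by (auto intro!: derivative_eq_intros Ck_on_has_derivative[OF Suc.prems that] simp: field_simps)
  have "Ck_on k S (\<lambda>x. frechet_derivative f (at x) v * inverse (2 * sqrt (f x)))" for v
    by (intro m Ck_on_inverse Ck_on_const i assms(1)) (use Suc.prems assms(2) in \<open>auto simp: less_le\<close>)
  with d show ?case by (rule Ck_on_Suc_derivI[OF assms(1)])
qed

lemma smooth_on_imp_continuous_on: "smooth_on S f \<Longrightarrow> continuous_on S f"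
  by (metis smooth_on_def Ck_on_imp_continuous_on)

lemma smooth_on_const: "smooth_on S (\<lambda>x. c)"
  and smooth_on_id: "smooth_on S (\<lambda>x. x)"
  by (simp_all add: smooth_on_def Ck_on_const Ck_on_id)

lemma smooth_on_subset: "smooth_on S f \<Longrightarrow> T \<subseteq> S \<Longrightarrow> smooth_on T f"
  using Ck_on_subset unfolding smooth_on_def by blast

lemma smooth_on_cong:
  assumes "open S" "smooth_on S f" "\<And>x. x \<in> S \<Longrightarrow> f x = g x"
  shows "smooth_on S g"
  unfolding smooth_on_def
proof
  fix k show "Ck_on k S g"
    by (rule Ck_on_cong[OF assms(1,3)]) (use assms(2) in \<open>simp_all add: smooth_on_def\<close>)
qed

lemma smooth_on_add:
  "open S \<Longrightarrow> smooth_on S f \<Longrightarrow> smooth_on S g \<Longrightarrow> smooth_on S (\<lambda>x. f x + g x)"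
  by (simp add: smooth_on_def Ck_on_add)

lemma smooth_on_linear:
  "open S \<Longrightarrow> bounded_linear h \<Longrightarrow> smooth_on S f \<Longrightarrow> smooth_on S (\<lambda>x. h (f x))"
  by (simp add: smooth_on_def Ck_on_linear)

lemma smooth_on_diff:
  "open S \<Longrightarrow> smooth_on S f \<Longrightarrow> smooth_on S g \<Longrightarrow> smooth_on S (\<lambda>x. f x - g x)"
  using smooth_on_add[of S f "\<lambda>x. - g x"]
    smooth_on_linear[OF _ bounded_linear_minus[OF bounded_linear_ident], of S g] by simp

lemma smooth_on_mult:
  fixes f g :: "'a::real_normed_vector \<Rightarrow> 'b::real_normed_algebra"
  shows "open S \<Longrightarrow> smooth_on S f \<Longrightarrow> smooth_on S g \<Longrightarrow> smooth_on S (\<lambda>x. f x * g x)"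
  by (simp add: smooth_on_def Ck_on_bilinear[OF _ bounded_bilinear_mult])

lemma smooth_on_divide:
  fixes f g :: "'a::real_normed_vector \<Rightarrow> 'b::real_normed_field"
  assumes "open S" "smooth_on S f" "smooth_on S g" "\<And>x. x \<in> S \<Longrightarrow> g x \<noteq> 0"
  shows "smooth_on S (\<lambda>x. f x / g x)"
  using assms smooth_on_mult[of S f "\<lambda>x. inverse (g x)"]
  by (simp add: smooth_on_def Ck_on_inverse divide_inverse)

lemma smooth_on_sqrt:
  "open S \<Longrightarrow> smooth_on S f \<Longrightarrow> (\<And>x. x \<in> S \<Longrightarrow> f x > 0) \<Longrightarrow> smooth_on S (\<lambda>x. sqrt (f x))"
  by (simp add: smooth_on_def Ck_on_sqrt)

lemma smooth_on_compose:
  fixes g :: "'b::euclidean_space \<Rightarrow> 'c::real_normed_vector"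
  shows "open S \<Longrightarrow> open T \<Longrightarrow> f ` S \<subseteq> T \<Longrightarrow> smooth_on S f \<Longrightarrow> smooth_on T g \<Longrightarrow>
    smooth_on S (\<lambda>x. g (f x))"
  unfolding smooth_on_def using Ck_on_compose by blast

lemma smooth_on_vec:
  fixes f :: "'i::finite \<Rightarrow> 'a::real_normed_vector \<Rightarrow> complex"
  assumes "open S" "\<And>i. smooth_on S (f i)"
  shows "smooth_on S (\<lambda>x. \<chi> i. f i x)"
proof -
  have "bounded_linear (axis i :: complex \<Rightarrow> complex^'i)" for i
    by (intro linear_conv_bounded_linear[THEN iffD1] linearI) (auto simp: vec_eq_iff axis_def)
  then have "smooth_on S (\<lambda>x. \<Sum>i\<in>UNIV. (axis i (f i x) :: complex^'i))"
    using assms unfolding smooth_on_def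
    by (intro allI Ck_on_sum) (auto intro: Ck_on_linear)
  moreover have "(\<Sum>i\<in>UNIV. (axis i (f i x) :: complex^'i)) = (\<chi> i. f i x)" for x
    by (simp add: vec_eq_iff axis_def if_distrib cong: if_cong)
  ultimately show ?thesis by simp
qed

lemma smooth_on_nth:
  fixes f :: "'a::real_normed_vector \<Rightarrow> complex^'i::finite"
  shows "open S \<Longrightarrow> smooth_on S f \<Longrightarrow> smooth_on S (\<lambda>x. f x $ i)"
  by (rule smooth_on_linear[OF _ bounded_linear_vec_nth])

lemma smooth_on_of_real:
  fixes f :: "'a::real_normed_vector \<Rightarrow> real"
  shows "open S \<Longrightarrow> smooth_on S f \<Longrightarrow> smooth_on S (\<lambda>x. complex_of_real (f x))"
  by (rule smooth_on_linear[OF _ bounded_linear_of_real])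

lemma smooth_on_cmod2:
  assumes "open S" "smooth_on S f"
  shows "smooth_on S (\<lambda>x. (cmod (f x))\<^sup>2)"
  unfolding cmod_power2 unfolding power2_eq_square
  by (intro smooth_on_add smooth_on_mult assms smooth_on_linear[OF _ bounded_linear_Re]
      smooth_on_linear[OF _ bounded_linear_Im])

lemma smooth_on_cmod:
  assumes "open S" "smooth_on S f" "\<And>x. x \<in> S \<Longrightarrow> f x \<noteq> 0"
  shows "smooth_on S (\<lambda>x. cmod (f x))"
  unfolding cmod_def power2_eq_square
proof (rule smooth_on_sqrt[OF assms(1)])
  show "smooth_on S (\<lambda>x. Re (f x) * Re (f x) + Im (f x) * Im (f x))"
    using smooth_on_cmod2[OF assms(1,2)] unfolding cmod_power2 unfolding power2_eq_square .
  show "0 < Re (f x) * Re (f x) + Im (f x) * Im (f x)" if "x \<in> S" for x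
    using assms(3)[OF that] by (simp add: complex_eq_iff sum_squares_gt_zero_iff)
qed

lemma smooth_on_if:
  "smooth_on S f \<Longrightarrow> smooth_on S g \<Longrightarrow> smooth_on S (\<lambda>x. if p then f x else g x)"
  by (cases p) simp_all


section \<open>Smooth implicit functions of one variable\<close>

lemma Ck_on_graph:
  fixes l :: "'a::euclidean_space \<Rightarrow> 'b::euclidean_space"
  assumes "open S" "Ck_on k S l"
  shows "Ck_on k S (\<lambda>p. (p, l p))"
proof -
  have "bounded_linear (\<lambda>p. (p, 0::'b))" "bounded_linear (\<lambda>r. (0::'a, r))"
    by (auto intro!: bounded_linear_intro[of _ 1] simp: norm_Pair)
  then have "Ck_on k S (\<lambda>p. (p, 0) + (0, l p))"
    by (intro Ck_on_add assms(1)) (auto intro: Ck_on_linear[OF assms(1)] assms(2) Ck_on_id)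
  then show ?thesis by simp
qed

text \<open>Write \<open>u\<close> and \<open>w\<close> for the increments of \<open>p\<close> and \<open>l p\<close>, and \<open>l'\<close> for the claimed derivative.
  The derivative of \<open>H\<close> maps \<open>(u, w)\<close> to \<open>D (0, 1) * (w - l' u)\<close>, and \<open>H\<close> does not change, so
  \<open>w - l' u\<close> is small compared with \<open>norm u + \<bar>w\<bar>\<close>, hence compared with \<open>norm u\<close>.\<close>

lemma has_derivative_implicit:
  fixes H :: "'a::real_normed_vector \<times> real \<Rightarrow> real" and l :: "'a \<Rightarrow> real"
  assumes D: "(H has_derivative D) (at (p, l p))" and h: "D (0, 1) \<noteq> 0"
    and z: "eventually (\<lambda>q. H (q, l q) = H (p, l p)) (at p)" and c: "isCont l p"
  shows "(l has_derivative (\<lambda>v. - D (v, 0) / D (0, 1))) (at p)"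
proof -
  define h where "h = D (0, 1)"
  define l' where "l' = (\<lambda>v. - D (v, 0) / h)"
  interpret D: bounded_linear D using D by (rule has_derivative_bounded_linear)
  have bl: "bounded_linear l'"
    unfolding l'_def divide_inverse
    by (intro bounded_linear_mult_const bounded_linear_minus
      bounded_linear_compose[OF D.bounded_linear_axioms]
      bounded_linear_Pair bounded_linear_ident bounded_linear_zero)
  obtain K where K: "K > 0" "\<And>v. norm (l' v) \<le> norm v * K"
    using bounded_linear.pos_bounded[OF bl] by blast
  have Dsplit: "D (v, r) = h * (r - l' v)" for v r
  proof -
    have "D (v, r) = D ((v, 0) + r *\<^sub>R (0, 1))" by simp
    also have "\<dots> = D (v, 0) + r * h" unfolding D.add D.scaleR by (simp add: h_def)
    finally show ?thesis using h by (simp add: l'_def h_def field_simps)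
  qed
  have "\<exists>d>0. \<forall>q. norm (q - p) < d \<longrightarrow> norm (l q - l p - l' (q - p)) \<le> e * norm (q - p)"
    if "e > 0" for e
  proof -
    \<comment> \<open>\<open>t \<le> 1/2\<close> allows to absorb \<open>t * \<bar>w - l' u\<bar>\<close>, at the price of a factor \<open>2\<close>.\<close>
    define t where "t = min (1/2) (e / (2 * (1 + K)))"
    have "t > 0" "t \<le> 1/2" "t \<le> e / (2 * (1 + K))"
      using K(1) \<open>e > 0\<close> unfolding t_def by (simp, linarith, linarith)
    then have t: "t > 0" "t \<le> 1/2" "2 * t * (1 + K) \<le> e"
      using K(1) by (auto simp: pos_le_divide_eq algebra_simps)
    have half: "x \<le> 2 * b" if "x \<le> b + 1/2 * x" for x b :: real using that by simp
    have "t * \<bar>h\<bar> > 0" using t h by (simp add: h_def)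
    then obtain d1 where d1: "d1 > 0" "\<And>y. norm (y - (p, l p)) < d1 \<Longrightarrow>
        norm (H y - H (p, l p) - D (y - (p, l p))) \<le> t * \<bar>h\<bar> * norm (y - (p, l p))"
      using D unfolding has_derivative_at_alt by blast
    have ev: "eventually (\<lambda>q. dist (l q) (l p) < d1 / 2) (at p)"
      using c half_gt_zero[OF d1(1)] unfolding isCont_def tendsto_iff by blast
    obtain d2 where d2: "d2 > 0" "\<And>q. q \<noteq> p \<Longrightarrow> dist q p < d2 \<Longrightarrow>
        dist (l q) (l p) < d1 / 2 \<and> H (q, l q) = H (p, l p)"
      using eventually_conj[OF ev z] unfolding eventually_at by auto
    show ?thesis
    proof (intro exI[of _ "min d2 (d1 / 2)"] conjI allI impI)
      show "min d2 (d1 / 2) > 0" using d1 d2 by simp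
      fix q assume q: "norm (q - p) < min d2 (d1 / 2)"
      define u w where "u = q - p" and "w = l q - l p"
      have eq: "dist (l q) (l p) < d1 / 2 \<and> H (q, l q) = H (p, l p)"
        using d2(2)[of q] q d1(1) by (cases "q = p") (auto simp: dist_norm)
      have n: "norm ((q, l q) - (p, l p)) \<le> norm u + \<bar>w\<bar>"
        using norm_Pair_le[of u w] by (simp add: u_def w_def)
      moreover have "norm u + \<bar>w\<bar> < d1"
        using q eq by (simp add: u_def w_def dist_real_def)
      ultimately have "norm (H (q, l q) - H (p, l p) - D ((q, l q) - (p, l p)))
          \<le> t * \<bar>h\<bar> * norm ((q, l q) - (p, l p))" by (intro d1) simp
      also have "\<dots> \<le> t * \<bar>h\<bar> * (norm u + \<bar>w\<bar>)" using n t by (intro mult_left_mono) auto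
      finally have "\<bar>h\<bar> * \<bar>w - l' u\<bar> \<le> \<bar>h\<bar> * (t * (norm u + \<bar>w\<bar>))"
        using eq by (simp add: Dsplit abs_mult u_def w_def mult_ac)
      then have 1: "\<bar>w - l' u\<bar> \<le> t * (norm u + \<bar>w\<bar>)" using h by (simp add: h_def)
      have "\<bar>w\<bar> \<le> \<bar>w - l' u\<bar> + norm u * K" using K(2)[of u] by simp
      then have "t * (norm u + \<bar>w\<bar>) \<le> t * (norm u + (\<bar>w - l' u\<bar> + norm u * K))"
        using t by (intro mult_left_mono) auto
      also have "\<dots> = t * (1 + K) * norm u + t * \<bar>w - l' u\<bar>" by (simp add: algebra_simps)
      also have "\<dots> \<le> t * (1 + K) * norm u + 1/2 * \<bar>w - l' u\<bar>"
        using t by (intro add_left_mono mult_right_mono) auto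
      finally have "\<bar>w - l' u\<bar> \<le> 2 * (t * (1 + K) * norm u)"
        using 1 half[of "\<bar>w - l' u\<bar>" "t * (1 + K) * norm u"] by (meson order_trans)
      also have "\<dots> = 2 * t * (1 + K) * norm u" by simp
      also have "\<dots> \<le> e * norm u" using t by (intro mult_right_mono) auto
      finally show "norm (l q - l p - l' (q - p)) \<le> e * norm (q - p)" by (simp add: u_def w_def)
    qed
  qed
  then show ?thesis using bl unfolding has_derivative_at_alt l'_def h_def by blast
qed

text \<open>Monotonicity in the last variable makes the solution continuous: the sign of \<open>H\<close> just below and
  just above the solution persists nearby. Then the solution is differentiable, and its derivative is
  a quotient of derivatives of \<open>H\<close> along the graph of the solution itself, so smoothness follows by
  bootstrapping.\<close>

lemma smooth_on_implicit:
  fixes H :: "'a::euclidean_space \<times> real \<Rightarrow> real" and l :: "'a \<Rightarrow> real"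
  assumes S: "open S" and H: "smooth_on (S \<times> {0<..}) H"
    and l: "\<And>p. p \<in> S \<Longrightarrow> l p > 0" and z: "\<And>p. p \<in> S \<Longrightarrow> H (p, l p) = 0"
    and mono: "\<And>p r s. p \<in> S \<Longrightarrow> 0 < r \<Longrightarrow> r < s \<Longrightarrow> H (p, r) < H (p, s)"
    and der: "\<And>p. p \<in> S \<Longrightarrow> \<exists>h. h \<noteq> 0 \<and> ((\<lambda>r. H (p, r)) has_real_derivative h) (at (l p))"
  shows "smooth_on S l"
proof -
  let ?T = "S \<times> {0::real<..}" and ?D = "\<lambda>p. frechet_derivative H (at (p, l p))"
  have T: "open ?T" by (simp add: S open_Times)
  have dH: "(H has_derivative frechet_derivative H (at y)) (at y)" if "y \<in> ?T" for y
    using H[unfolded smooth_on_def, rule_format, of "Suc 0"] that by (rule Ck_on_has_derivative)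
  have HT: "isCont H y" if "y \<in> ?T" for y
    using dH[OF that] has_derivative_continuous by blast
  have evS: "eventually (\<lambda>q. q \<in> S) (at p)" if "p \<in> S" for p
    using S that eventually_at_topological by blast
  have Hq: "((\<lambda>q. H (q, r)) \<longlongrightarrow> H (p, r)) (at p)" if "p \<in> S" "r > 0" for p r
  proof -
    have "((\<lambda>q. (q, r)) \<longlongrightarrow> (p, r)) (at p)" by (intro tendsto_intros)
    then show ?thesis using isCont_tendsto_compose[OF HT] that by fastforce
  qed
  have cont: "isCont l p" if p: "p \<in> S" for p
    unfolding isCont_def
  proof (rule order_tendstoI)
    fix a assume a: "a < l p"
    define b where "b = max a (l p / 2)"
    have b: "a \<le> b" "0 < b" "b < l p" using a l[OF p] by (auto simp: b_def)
    have "H (p, b) < 0" using mono[OF p b(2,3)] z[OF p] by simp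
    then have "eventually (\<lambda>q. H (q, b) < 0) (at p)" using Hq[OF p b(2)] order_tendstoD(2) by blast
    then show "eventually (\<lambda>q. a < l q) (at p)"
      using evS[OF p]
    proof eventually_elim
      case (elim q)
      have "\<not> l q \<le> b" using mono[of q "l q" b] z[of q] l[of q] elim by (cases "l q = b") auto
      then show ?case using b by simp
    qed
  next
    fix b assume b: "l p < b"
    then have b0: "b > 0" using l[OF p] by simp
    have "H (p, b) > 0" using mono[OF p l[OF p] b] z[OF p] by simp
    then have "eventually (\<lambda>q. H (q, b) > 0) (at p)" using Hq[OF p b0] order_tendstoD(1) by blast
    then show "eventually (\<lambda>q. l q < b) (at p)"
      using evS[OF p]
    proof eventually_elim
      case (elim q)
      have "\<not> b \<le> l q" using mono[of q b "l q"] z[of q] b0 elim by (cases "l q = b") auto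
      then show ?case by simp
    qed
  qed
  have D01: "?D p (0, 1) \<noteq> 0" if p: "p \<in> S" for p
  proof -
    have "((\<lambda>r. (p, r)) has_derivative (\<lambda>r. (0, r))) (at (l p))"
      by (auto intro!: derivative_eq_intros)
    then have "((\<lambda>r. H (p, r)) has_derivative (\<lambda>r. ?D p (0, r))) (at (l p))"
      by (rule has_derivative_compose) (use dH p l in simp)
    moreover obtain h where "h \<noteq> 0" "((\<lambda>r. H (p, r)) has_real_derivative h) (at (l p))"
      using der[OF p] by blast
    ultimately have "(\<lambda>r. ?D p (0, r)) = (\<lambda>r. h * r)"
      using has_derivative_unique unfolding has_field_derivative_def by blast
    then show ?thesis using \<open>h \<noteq> 0\<close> by (metis mult.right_neutral)
  qed
  have dl: "(l has_derivative (\<lambda>v. - ?D p (v, 0) / ?D p (0, 1))) (at p)" if p: "p \<in> S" for p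
  proof (rule has_derivative_implicit[where D = "?D p", OF _ D01[OF p] _ cont[OF p]])
    show "(H has_derivative ?D p) (at (p, l p))" using dH p l by simp
    show "eventually (\<lambda>q. H (q, l q) = H (p, l p)) (at p)"
      using evS[OF p] by eventually_elim (simp add: z p)
  qed
  have "Ck_on k S l" for k
  proof (induction k)
    case 0
    then show ?case using cont by (simp add: continuous_at_imp_continuous_on)
  next
    case (Suc k)
    have D: "Ck_on k S (\<lambda>p. ?D p v)" for v
    proof (rule Ck_on_compose[OF S T _ Ck_on_graph[OF S Suc]])
      show "(\<lambda>p. (p, l p)) ` S \<subseteq> ?T" using l by auto
      show "Ck_on k ?T (\<lambda>y. frechet_derivative H (at y) v)"
        using H[unfolded smooth_on_def, rule_format, of "Suc k"] unfolding Ck_on.simps by blast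
    qed
    have "Ck_on k S (\<lambda>p. - (?D p (v, 0) * inverse (?D p (0, 1))))" for v
      by (rule Ck_on_linear[OF S bounded_linear_minus[OF bounded_linear_ident]
            Ck_on_bilinear[OF S bounded_bilinear_mult D Ck_on_inverse[OF S D01 D]]])
    then have "Ck_on k S (\<lambda>p. - ?D p (v, 0) / ?D p (0, 1))" for v
      by (simp add: divide_inverse)
    with dl show ?case by (rule Ck_on_Suc_derivI[OF S])
  qed
  then show ?thesis by (simp add: smooth_on_def)
qed


section \<open>Smooth maps in affine charts of the Grassmannian\<close>

lemma bij_4_distinct:
  assumes "bij (\<sigma> :: 4 \<Rightarrow> 4)"
  shows "distinct [\<sigma> 1, \<sigma> 2, \<sigma> 3, \<sigma> 4]"
  using assms by (auto simp: bij_def inj_eq)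

lemma bij_4_neq:
  assumes "bij (\<sigma> :: 4 \<Rightarrow> 4)"
  shows "\<sigma> 2 \<noteq> \<sigma> 1" "\<sigma> 3 \<noteq> \<sigma> 1" "\<sigma> 3 \<noteq> \<sigma> 2" "\<sigma> 4 \<noteq> \<sigma> 1" "\<sigma> 4 \<noteq> \<sigma> 2" "\<sigma> 4 \<noteq> \<sigma> 3"
    "\<sigma> 1 \<noteq> \<sigma> 2" "\<sigma> 1 \<noteq> \<sigma> 3" "\<sigma> 2 \<noteq> \<sigma> 3" "\<sigma> 1 \<noteq> \<sigma> 4" "\<sigma> 2 \<noteq> \<sigma> 4" "\<sigma> 3 \<noteq> \<sigma> 4"
  using bij_4_distinct[OF assms] by auto

lemma bij_4_all:
  assumes "bij (\<sigma> :: 4 \<Rightarrow> 4)"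
  shows "(\<forall>k. P k) \<longleftrightarrow> P (\<sigma> 1) \<and> P (\<sigma> 2) \<and> P (\<sigma> 3) \<and> P (\<sigma> 4)"
proof -
  have "(\<forall>k. P k) \<longleftrightarrow> (\<forall>k. P (\<sigma> k))" using assms by (metis bij_pointE)
  then show ?thesis by (simp only: forall_4)
qed

lemma graph_frame_nth:
  assumes "bij \<sigma>" "graph_frame \<sigma> z = (a, b)"
  shows "a $ \<sigma> 1 = 1" "a $ \<sigma> 2 = 0" "a $ \<sigma> 3 = z $ 1" "a $ \<sigma> 4 = z $ 2"
    "b $ \<sigma> 1 = 0" "b $ \<sigma> 2 = 1" "b $ \<sigma> 3 = z $ 3" "b $ \<sigma> 4 = z $ 4"
  using bij_4_distinct[OF assms(1)] assms(2) by (auto simp: graph_frame_def axis_def)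

text \<open>The chart \<open>\<sigma>\<close> in terms of an arbitrary frame: row reduction expresses the affine coordinates as
  quotients of minors. They are therefore smooth functions of any smooth frame, in particular of the
  frames that come from another chart.\<close>

definition frame_coords :: "(4 \<Rightarrow> 4) \<Rightarrow> (complex^4) \<times> (complex^4) \<Rightarrow> complex^4" where
  "frame_coords \<sigma> f = (\<chi> k.
     (if k = 1 then minor f (\<sigma> 3) (\<sigma> 2) else if k = 2 then minor f (\<sigma> 4) (\<sigma> 2)
      else if k = 3 then minor f (\<sigma> 1) (\<sigma> 3) else minor f (\<sigma> 1) (\<sigma> 4)) / minor f (\<sigma> 1) (\<sigma> 2))"

lemma param_frame_coords:
  assumes \<sigma>: "bij \<sigma>" and F: "is_frame L f" and nz: "minor f (\<sigma> 1) (\<sigma> 2) \<noteq> 0"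
  shows "param \<sigma> (frame_coords \<sigma> f) = L"
proof -
  obtain a b where f: "f = (a, b)" by force
  have L: "L = vec.span {a, b}" using F by (auto simp: is_frame_def f)
  define d where "d = minor f (\<sigma> 1) (\<sigma> 2)"
  \<comment> \<open>Cramer's rule: the basis of \<open>L\<close> that is dual to the coordinates \<open>\<sigma> 1\<close> and \<open>\<sigma> 2\<close>.\<close>
  define a' b' where "a' = (b $ \<sigma> 2 / d) *s a + (- a $ \<sigma> 2 / d) *s b"
    and "b' = (- b $ \<sigma> 1 / d) *s a + (a $ \<sigma> 1 / d) *s b"
  obtain a'' b'' where gf: "graph_frame \<sigma> (frame_coords \<sigma> f) = (a'', b'')" by force
  have "a'' = a'" "b'' = b'"
    unfolding vec_eq_iff bij_4_all[OF \<sigma>] graph_frame_nth[OF \<sigma> gf] using nz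
    by (auto simp: frame_coords_def a'_def b'_def d_def f minor_def divide_simps)
  moreover have "a' \<in> L" "b' \<in> L"
    unfolding L a'_def b'_def by (intro vec.span_add vec.span_scale vec.span_base; simp)+
  ultimately have "param \<sigma> (frame_coords \<sigma> f) \<subseteq> L"
    by (simp add: param_def gf vec.span_minimal L vec.subspace_span)
  moreover have "param \<sigma> (frame_coords \<sigma> f) \<in> Gr42" "L \<in> Gr42"
    using param_in_Gr42[OF \<sigma>] is_frame_Gr42[OF F] by auto
  ultimately show ?thesis
    unfolding Gr42_def by (metis (mono_tags, lifting) mem_Collect_eq order_refl vec.subspace_dim_equal)
qed

lemma minor_graph_frame_12:
  assumes "bij \<sigma>" shows "minor (graph_frame \<sigma> z) (\<sigma> 1) (\<sigma> 2) = 1"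
proof -
  obtain a b where ab: "graph_frame \<sigma> z = (a, b)" by force
  show ?thesis by (simp add: ab minor_def graph_frame_nth[OF assms ab])
qed

lemma range_param_iff:
  assumes \<sigma>: "bij \<sigma>" and F: "is_frame L f"
  shows "L \<in> range (param \<sigma>) \<longleftrightarrow> minor f (\<sigma> 1) (\<sigma> 2) \<noteq> 0"
proof
  assume "L \<in> range (param \<sigma>)"
  then obtain z where z: "L = param \<sigma> z" by blast
  obtain c where "c \<noteq> 0" and c: "\<And>i j. minor (graph_frame \<sigma> z) i j = c * minor f i j"
    by (rule minor_change_of_frame[OF F is_frame_graph_frame[OF \<sigma>, of z, folded z]]) (rule that)
  from c[of "\<sigma> 1" "\<sigma> 2"] show "minor f (\<sigma> 1) (\<sigma> 2) \<noteq> 0"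
    by (auto simp: minor_graph_frame_12[OF \<sigma>])
next
  assume "minor f (\<sigma> 1) (\<sigma> 2) \<noteq> 0"
  from param_frame_coords[OF \<sigma> F this] show "L \<in> range (param \<sigma>)" by blast
qed

lemma chart_param: "bij \<sigma> \<Longrightarrow> chart \<sigma> (param \<sigma> z) = z"
  by (simp add: chart_def inj_param)

lemma smooth_on_minor_graph_frame: "smooth_on UNIV (\<lambda>z. minor (graph_frame \<sigma> z) i j)"
proof -
  have *: "smooth_on UNIV (\<lambda>z :: complex^4. axis k (f z) $ i)" if "smooth_on UNIV f" for k i f
    using that by (cases "k = i") (auto simp: axis_def smooth_on_const)
  show ?thesis
    unfolding minor_def graph_frame_def case_prod_conv vector_add_component
    by (intro smooth_on_diff smooth_on_mult smooth_on_add * smooth_on_const smooth_on_nth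
        smooth_on_id open_UNIV)
qed

lemma smooth_on_transition:
  "open {z. minor (graph_frame \<sigma> z) (\<tau> 1) (\<tau> 2) \<noteq> 0}"
  "smooth_on {z. minor (graph_frame \<sigma> z) (\<tau> 1) (\<tau> 2) \<noteq> 0} (\<lambda>z. frame_coords \<tau> (graph_frame \<sigma> z))"
proof -
  let ?A = "{z. minor (graph_frame \<sigma> z) (\<tau> 1) (\<tau> 2) \<noteq> 0}"
  have "?A = (\<lambda>z. minor (graph_frame \<sigma> z) (\<tau> 1) (\<tau> 2)) -` (- {0})" by auto
  then show A: "open ?A"
    using smooth_on_imp_continuous_on[OF smooth_on_minor_graph_frame]
    by (metis continuous_open_vimage open_Compl closed_singleton continuous_on_eq_continuous_within
        open_vimage)
  have m: "smooth_on ?A (\<lambda>z. minor (graph_frame \<sigma> z) i j)" for i j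
    by (rule smooth_on_subset[OF smooth_on_minor_graph_frame]) simp
  show "smooth_on ?A (\<lambda>z. frame_coords \<tau> (graph_frame \<sigma> z))"
    unfolding frame_coords_def by (intro smooth_on_vec smooth_on_divide smooth_on_if m A) auto
qed

text \<open>Between a pair of arbitrary charts the map reads \<open>G\<close> with a transition map on either side.\<close>

lemma smooth_Gr_on_charts:
  assumes \<sigma>: "bij \<sigma>" and \<tau>: "bij \<tau>" and S: "open S" and G: "smooth_on S G"
  shows "smooth_Gr_on (param \<sigma> ` S) (\<lambda>L. param \<tau> (G (chart \<sigma> L)))"
proof -
  define A where "A = (\<lambda>(\<alpha> :: 4 \<Rightarrow> 4) (\<beta> :: 4 \<Rightarrow> 4). {z. minor (graph_frame \<alpha> z) (\<beta> 1) (\<beta> 2) \<noteq> 0})"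
  define T where "T = (\<lambda>(\<alpha> :: 4 \<Rightarrow> 4) (\<beta> :: 4 \<Rightarrow> 4) z. frame_coords \<beta> (graph_frame \<alpha> z))"
  have A: "open (A \<alpha> \<beta>)" and T: "smooth_on (A \<alpha> \<beta>) (T \<alpha> \<beta>)" for \<alpha> \<beta>
    unfolding A_def T_def by (rule smooth_on_transition)+
  have rng: "param \<alpha> z \<in> range (param \<beta>) \<longleftrightarrow> z \<in> A \<alpha> \<beta>"
    and pT: "z \<in> A \<alpha> \<beta> \<Longrightarrow> param \<beta> (T \<alpha> \<beta> z) = param \<alpha> z"
    if "bij \<alpha>" "bij \<beta>" for \<alpha> \<beta> z
    using range_param_iff[OF that(2) is_frame_graph_frame[OF that(1), of z]]
      param_frame_coords[OF that(2) is_frame_graph_frame[OF that(1), of z]]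
    by (auto simp: A_def T_def)
  have ch: "chart \<beta> (param \<alpha> z) = T \<alpha> \<beta> z" if "bij \<alpha>" "bij \<beta>" "z \<in> A \<alpha> \<beta>" for \<alpha> \<beta> z
    using pT[OF that] chart_param[OF that(2)] by metis
  have W: "param \<alpha> z \<in> param \<sigma> ` S \<longleftrightarrow> z \<in> A \<alpha> \<sigma> \<and> T \<alpha> \<sigma> z \<in> S" if "bij \<alpha>" for \<alpha> z
  proof
    assume "param \<alpha> z \<in> param \<sigma> ` S"
    then obtain s where s: "s \<in> S" "param \<alpha> z = param \<sigma> s" by blast
    then have "z \<in> A \<alpha> \<sigma>" using rng[OF that \<sigma>] by blast
    moreover have "T \<alpha> \<sigma> z = s" using ch[OF that \<sigma> calculation] chart_param[OF \<sigma>] s by simp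
    ultimately show "z \<in> A \<alpha> \<sigma> \<and> T \<alpha> \<sigma> z \<in> S" using s by blast
  next
    assume "z \<in> A \<alpha> \<sigma> \<and> T \<alpha> \<sigma> z \<in> S"
    then show "param \<alpha> z \<in> param \<sigma> ` S" using pT[OF that \<sigma>, of z] by (metis image_eqI)
  qed
  have V1: "open (A \<alpha> \<sigma> \<inter> T \<alpha> \<sigma> -` S)" for \<alpha>
    by (rule continuous_open_preimage[OF smooth_on_imp_continuous_on[OF T] A S])
  have "open V \<and> smooth_on V (\<lambda>z. chart \<beta> (param \<tau> (G (chart \<sigma> (param \<alpha> z)))))"
    if ab: "bij \<alpha>" "bij \<beta>" and V: "V = {z. param \<alpha> z \<in> param \<sigma> ` S \<and>
      param \<tau> (G (chart \<sigma> (param \<alpha> z))) \<in> range (param \<beta>)}" for \<alpha> \<beta> V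
  proof -
    let ?V1 = "A \<alpha> \<sigma> \<inter> T \<alpha> \<sigma> -` S" and ?h = "\<lambda>z. G (T \<alpha> \<sigma> z)"
    have h: "smooth_on ?V1 ?h"
      by (rule smooth_on_compose[OF V1 S _ smooth_on_subset[OF T] G]) auto
    have V': "V = ?V1 \<inter> ?h -` A \<tau> \<beta>"
      unfolding V using W[OF ab(1)] ch[OF ab(1) \<sigma>] rng[OF \<tau> ab(2)] by auto
    then have oV: "open V"
      using continuous_open_preimage[OF smooth_on_imp_continuous_on[OF h] V1 A] by simp
    have "smooth_on V (\<lambda>z. T \<tau> \<beta> (?h z))"
      by (rule smooth_on_compose[OF oV A _ smooth_on_subset[OF h] T]) (auto simp: V')
    then have "smooth_on V (\<lambda>z. chart \<beta> (param \<tau> (G (chart \<sigma> (param \<alpha> z)))))"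
      by (rule smooth_on_cong[OF oV]) (auto simp: V' ch[OF ab(1) \<sigma>] ch[OF \<tau> ab(2)])
    with oV show ?thesis by blast
  qed
  moreover have "open_Gr (param \<sigma> ` S)"
    unfolding open_Gr_def
  proof (intro conjI allI impI)
    show "param \<sigma> ` S \<subseteq> Gr42" using param_in_Gr42[OF \<sigma>] by blast
    fix \<alpha> :: "4 \<Rightarrow> 4" assume "bij \<alpha>"
    then have "param \<alpha> -` (param \<sigma> ` S) = A \<alpha> \<sigma> \<inter> T \<alpha> \<sigma> -` S" using W by auto
    then show "open (param \<alpha> -` (param \<sigma> ` S))" using V1 by simp
  qed
  ultimately show ?thesis
    unfolding smooth_Gr_on_def Let_def using param_in_Gr42[OF \<tau>] by blast
qed

lemma smooth_map_charts:
  assumes "bij \<sigma>" "bij \<tau>" "open S" "X \<subseteq> S" "smooth_on S G" "G ` X \<subseteq> Y"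
  shows "smooth_map (param \<sigma> ` X) (param \<tau> ` Y) (\<lambda>L. param \<tau> (G (chart \<sigma> L)))"
  unfolding smooth_map_def
proof (intro conjI ballI exI)
  show "(\<lambda>L. param \<tau> (G (chart \<sigma> L))) ` param \<sigma> ` X \<subseteq> param \<tau> ` Y"
    using assms(6) by (auto simp: chart_param[OF assms(1)])
  fix p assume "p \<in> param \<sigma> ` X"
  then show "p \<in> param \<sigma> ` S" using assms(4) by blast
qed (auto intro: smooth_Gr_on_charts assms)

text \<open>Two sets that each lie in a single chart can be compared in coordinates.\<close>

lemma diffeomorphic_charts:
  assumes "bij \<sigma>" "bij \<tau>" "open S" "open T" "X \<subseteq> S" "Y \<subseteq> T" "smooth_on S G" "smooth_on T H"
    and "G ` X \<subseteq> Y" "H ` Y \<subseteq> X" "\<And>z. z \<in> X \<Longrightarrow> H (G z) = z" "\<And>w. w \<in> Y \<Longrightarrow> G (H w) = w"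
  shows "diffeomorphic (param \<sigma> ` X) (param \<tau> ` Y)"
  unfolding diffeomorphic_def
proof (intro exI conjI)
  show "smooth_map (param \<sigma> ` X) (param \<tau> ` Y) (\<lambda>L. param \<tau> (G (chart \<sigma> L)))"
    by (rule smooth_map_charts[OF assms(1,2,3,5,7,9)])
  show "smooth_map (param \<tau> ` Y) (param \<sigma> ` X) (\<lambda>L. param \<sigma> (H (chart \<tau> L)))"
    by (rule smooth_map_charts[OF assms(2,1,4,6,8,10)])
qed (auto simp: assms chart_param)


section \<open>Projection along the orbits of the positive torus\<close>

text \<open>The plane with coordinates \<open>z\<close> has the Pluecker coordinates (labelled by the positions in the chart)
  \<open>P\<^sup>1\<^sup>2 = 1\<close>, \<open>P\<^sup>1\<^sup>3 = z $ 3\<close>, \<open>P\<^sup>1\<^sup>4 = z $ 4\<close>, \<open>P\<^sup>2\<^sup>3 = - z $ 1\<close>, \<open>P\<^sup>2\<^sup>4 = - z $ 2\<close> and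
  \<open>P\<^sup>3\<^sup>4 = z $ 1 * z $ 4 - z $ 2 * z $ 3\<close>. The weight is the sum of their squared moduli, and the fibre
  is given by the equations of the moment map with this denominator cleared.\<close>

definition weight :: "complex^4 \<Rightarrow> real" where
  "weight z = 1 + (cmod (z $ 1))\<^sup>2 + (cmod (z $ 2))\<^sup>2 + (cmod (z $ 3))\<^sup>2 + (cmod (z $ 4))\<^sup>2
     + (cmod (z $ 1 * z $ 4 - z $ 2 * z $ 3))\<^sup>2"

definition coord_fibre :: "real^4 \<Rightarrow> (complex^4) set" where
  "coord_fibre a = {z.
     1 + (cmod (z $ 3))\<^sup>2 + (cmod (z $ 4))\<^sup>2 = a $ 1 * weight z \<and>
     1 + (cmod (z $ 1))\<^sup>2 + (cmod (z $ 2))\<^sup>2 = a $ 2 * weight z \<and>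
     (cmod (z $ 1))\<^sup>2 + (cmod (z $ 3))\<^sup>2 + (cmod (z $ 1 * z $ 4 - z $ 2 * z $ 3))\<^sup>2 = a $ 3 * weight z \<and>
     (cmod (z $ 2))\<^sup>2 + (cmod (z $ 4))\<^sup>2 + (cmod (z $ 1 * z $ 4 - z $ 2 * z $ 3))\<^sup>2 = a $ 4 * weight z}"

text \<open>For \<open>{3, j, k, l} = {1, 2, 3, 4}\<close> this is the value that the moment map prescribes for the difference
  of the squared moduli of \<open>P\<^sup>k\<^sup>l\<close> and \<open>P\<^sup>3\<^sup>j\<close>, both divided by the weight.\<close>

definition gap :: "real^4 \<Rightarrow> 4 \<Rightarrow> real" where
  "gap a j = 1 - a $ 3 - a $ j"

text \<open>One of the two kinds of chambers, up to relabelling: the coordinate \<open>3\<close> is small. The moment map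
  bounds a sum of two coordinates by \<open>1\<close> if the corresponding Pluecker coordinate vanishes, so in this
  chamber \<open>P\<^sup>1\<^sup>2\<close>, \<open>P\<^sup>1\<^sup>4\<close> and \<open>P\<^sup>2\<^sup>4\<close> have no zeros on the fibre. This is what the set of stable
  points expresses, together with the condition that the third column of a frame is not zero.\<close>

definition third_light :: "real^4 \<Rightarrow> bool" where
  "third_light a \<longleftrightarrow> 0 < a $ 3 \<and> 0 < gap a 1 \<and> 0 < gap a 2 \<and> 0 < gap a 4
     \<and> a $ 1 + a $ 2 + a $ 3 + a $ 4 = 2"

definition stable_pts :: "(complex^4) set" where
  "stable_pts = {z. z $ 2 \<noteq> 0 \<and> z $ 4 \<noteq> 0 \<and> (z $ 1 \<noteq> 0 \<or> z $ 3 \<noteq> 0)}"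

text \<open>The squared modulus of \<open>P\<^sup>3\<^sup>j * P\<^sup>k\<^sup>l\<close>. The three products change by a common factor along an orbit of
  the torus.\<close>

definition cross_term :: "complex^4 \<Rightarrow> 4 \<Rightarrow> real" where
  "cross_term z j = (cmod (if j = 4 then z $ 1 * z $ 4 - z $ 2 * z $ 3
     else if j = 2 then z $ 1 * z $ 4 else z $ 2 * z $ 3))\<^sup>2"

text \<open>On the orbit of \<open>z\<close> under the positive torus, a point of the fibre over \<open>a\<close> has normalized squared
  moduli \<open>A\<close> of \<open>P\<^sup>k\<^sup>l\<close> and \<open>B\<close> of \<open>P\<^sup>3\<^sup>j\<close> with \<open>A - B = gap a j\<close> and \<open>A * B = r * cross_term z j\<close>, where
  \<open>r > 0\<close> is the same for all \<open>j\<close>. The root is \<open>A + B\<close>. The six numbers add up to \<open>1\<close>, and this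
  determines \<open>r\<close>. Below, \<open>upper a z j\<close> is \<open>A\<close>.\<close>

definition orbit_root :: "real^4 \<Rightarrow> complex^4 \<Rightarrow> real \<Rightarrow> 4 \<Rightarrow> real" where
  "orbit_root a z r j = sqrt ((gap a j)\<^sup>2 + 4 * r * cross_term z j)"

definition orbit_param :: "real^4 \<Rightarrow> complex^4 \<Rightarrow> real" where
  "orbit_param a z = (THE r. 0 < r \<and> orbit_root a z r 1 + orbit_root a z r 2 + orbit_root a z r 4 = 1)"

definition upper :: "real^4 \<Rightarrow> complex^4 \<Rightarrow> 4 \<Rightarrow> real" where
  "upper a z j = (orbit_root a z (orbit_param a z) j + gap a j) / 2"

text \<open>The point of the fibre over \<open>a\<close> on the orbit of \<open>z\<close> under the positive torus, found from the moduli of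
  its Pluecker coordinates: the arguments of \<open>z $ 2\<close> and \<open>z $ 4\<close> do not change on the orbit, and neither does
  the direction of \<open>(z $ 1 * cmod (z $ 4), z $ 3 * cmod (z $ 2))\<close>. The formula does not divide by \<open>z $ 1\<close>
  or \<open>z $ 3\<close>, one of which may vanish.\<close>

definition orbit_proj :: "real^4 \<Rightarrow> complex^4 \<Rightarrow> complex^4" where
  "orbit_proj a z = (\<chi> k.
     if k = 1 then of_real (cmod (z $ 4) * sqrt (orbit_param a z / (upper a z 2 * upper a z 4))) * z $ 1
     else if k = 2 then of_real (sqrt (upper a z 1 / upper a z 4) / cmod (z $ 2)) * z $ 2
     else if k = 3 then of_real (cmod (z $ 2) * sqrt (orbit_param a z / (upper a z 1 * upper a z 4))) * z $ 3
     else of_real (sqrt (upper a z 2 / upper a z 4) / cmod (z $ 4)) * z $ 4)"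

lemma cross_term_nonneg: "0 \<le> cross_term z j"
  by (simp add: cross_term_def)

lemma open_stable_pts: "open stable_pts"
proof -
  have *: "open {z :: complex^4. z $ i \<noteq> 0}" for i
    by (intro open_Collect_neq continuous_intros)
  have eq: "stable_pts = {z. z $ 2 \<noteq> 0} \<inter> {z. z $ 4 \<noteq> 0} \<inter> ({z. z $ 1 \<noteq> 0} \<union> {z. z $ 3 \<noteq> 0})"
    by (auto simp: stable_pts_def)
  show ?thesis unfolding eq by (intro open_Int open_Un *)
qed

lemma stable_pts_cross_term: "z \<in> stable_pts \<Longrightarrow> 0 < cross_term z 2 \<or> 0 < cross_term z 1"
  by (auto simp: stable_pts_def cross_term_def)

lemma orbit_root_mono:
  assumes "0 \<le> r" "r \<le> s" shows "orbit_root a z r j \<le> orbit_root a z s j"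
  using assms cross_term_nonneg by (auto simp: orbit_root_def intro: mult_right_mono)

lemma orbit_root_strict_mono:
  assumes "0 \<le> r" "r < s" "0 < cross_term z j" shows "orbit_root a z r j < orbit_root a z s j"
  using assms by (simp add: orbit_root_def)

lemma orbit_root_sum_strict_mono:
  assumes "z \<in> stable_pts" "0 \<le> r" "r < s"
  shows "orbit_root a z r 1 + orbit_root a z r 2 + orbit_root a z r 4 < orbit_root a z s 1 + orbit_root a z s 2 + orbit_root a z s 4"
  using stable_pts_cross_term[OF assms(1)]
proof
  assume "0 < cross_term z 2"
  from orbit_root_strict_mono[OF assms(2,3) this, of a] orbit_root_mono[of r s a z 1] orbit_root_mono[of r s a z 4] assms
  show ?thesis by simp
next
  assume "0 < cross_term z 1"
  from orbit_root_strict_mono[OF assms(2,3) this, of a] orbit_root_mono[of r s a z 2] orbit_root_mono[of r s a z 4] assms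
  show ?thesis by simp
qed

lemma gap_pos: "third_light a \<Longrightarrow> j \<in> {1, 2, 4} \<Longrightarrow> 0 < gap a j"
  by (auto simp: third_light_def)

lemma gap_le_orbit_root:
  assumes "third_light a" "0 \<le> r" "j \<in> {1, 2, 4}" shows "gap a j \<le> orbit_root a z r j"
proof -
  have "sqrt ((gap a j)\<^sup>2) \<le> orbit_root a z r j"
    unfolding orbit_root_def using assms cross_term_nonneg[of z j] by (intro real_sqrt_le_mono) simp
  then show ?thesis using gap_pos[OF assms(1,3)] by simp
qed

text \<open>At \<open>r = 0\<close> the three roots add up to \<open>1 - 2 * a $ 3\<close>, and they grow without bound.\<close>

lemma orbit_param_ex:
  assumes a: "third_light a" and z: "z \<in> stable_pts"
  shows "\<exists>r>0. orbit_root a z r 1 + orbit_root a z r 2 + orbit_root a z r 4 = 1"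
proof -
  let ?f = "\<lambda>r. orbit_root a z r 1 + orbit_root a z r 2 + orbit_root a z r 4"
  have f0: "?f 0 < 1"
    using a by (auto simp: third_light_def orbit_root_def gap_def)
  obtain j where j: "j \<in> {1, 2}" "0 < cross_term z j" using stable_pts_cross_term[OF z] by auto
  define r where "r = 1 / (4 * cross_term z j)"
  have r: "0 < r" "4 * r * cross_term z j = 1" using j by (auto simp: r_def)
  have "1 \<le> orbit_root a z r j" using r by (simp add: orbit_root_def)
  then have f1: "1 \<le> ?f r"
    using j gap_pos[OF a, of 1] gap_pos[OF a, of 2] gap_pos[OF a, of 4] r
      gap_le_orbit_root[OF a, of r 1 z] gap_le_orbit_root[OF a, of r 2 z]
      gap_le_orbit_root[OF a, of r 4 z] by auto
  have "\<exists>t\<ge>0. t \<le> r \<and> ?f t = 1"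
    by (rule IVT') (use f0 f1 r in \<open>auto simp: orbit_root_def intro!: continuous_intros\<close>)
  then show ?thesis using f0 by (metis less_le less_irrefl)
qed

lemma orbit_param_unique:
  assumes "z \<in> stable_pts" "0 < r" "orbit_root a z r 1 + orbit_root a z r 2 + orbit_root a z r 4 = 1"
  shows "orbit_param a z = r"
  unfolding orbit_param_def
proof (rule the_equality)
  fix s assume "0 < s \<and> orbit_root a z s 1 + orbit_root a z s 2 + orbit_root a z s 4 = 1"
  then show "s = r"
    using orbit_root_sum_strict_mono[OF assms(1), of s r a] orbit_root_sum_strict_mono[OF assms(1), of r s a] assms
    by (cases s r rule: linorder_cases) auto
qed (use assms in simp)

lemma orbit_param_works:
  assumes "third_light a" "z \<in> stable_pts"
  shows "0 < orbit_param a z" "orbit_root a z (orbit_param a z) 1 + orbit_root a z (orbit_param a z) 2 + orbit_root a z (orbit_param a z) 4 = 1"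
  using orbit_param_ex[OF assms] orbit_param_unique[OF assms(2)] by metis+

lemma smooth_on_cross_term: "smooth_on UNIV (\<lambda>z. cross_term z j)"
  unfolding cross_term_def
  by (intro smooth_on_cmod2 smooth_on_if smooth_on_diff smooth_on_mult smooth_on_nth smooth_on_id
      open_UNIV)

lemma smooth_on_orbit_param:
  assumes a: "third_light a"
  shows "smooth_on stable_pts (orbit_param a)"
proof -
  let ?H = "\<lambda>y. orbit_root a (fst y) (snd y) 1 + orbit_root a (fst y) (snd y) 2 + orbit_root a (fst y) (snd y) 4 - 1"
  let ?T = "stable_pts \<times> {0::real<..}"
  have T: "open ?T" by (simp add: open_stable_pts open_Times)
  have arg: "0 < (gap a j)\<^sup>2 + 4 * r * cross_term z j" if "0 < r" "j \<in> {1, 2, 4}" for z j r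
    using gap_pos[OF a, of j] that cross_term_nonneg[of z j]
    by (intro add_pos_nonneg mult_nonneg_nonneg) auto
  have "smooth_on ?T (\<lambda>y. orbit_root a (fst y) (snd y) j)" if "j \<in> {1, 2, 4}" for j
    unfolding orbit_root_def
  proof (intro smooth_on_sqrt smooth_on_add smooth_on_mult smooth_on_const T)
    show "smooth_on ?T snd"
      using smooth_on_linear[OF T bounded_linear_snd smooth_on_id] by simp
    have "smooth_on ?T fst"
      using smooth_on_linear[OF T bounded_linear_fst smooth_on_id] by simp
    then show "smooth_on ?T (\<lambda>y. cross_term (fst y) j)"
      using smooth_on_compose[OF T open_UNIV _ _ smooth_on_cross_term] by blast
    show "0 < (gap a j)\<^sup>2 + 4 * snd y * cross_term (fst y) j" if "y \<in> ?T" for y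
      using arg \<open>j \<in> _\<close> that by auto
  qed
  then have H: "smooth_on ?T ?H" by (intro smooth_on_add smooth_on_diff smooth_on_const T) simp_all
  show ?thesis
  proof (rule smooth_on_implicit[OF open_stable_pts H])
    fix z assume z: "z \<in> stable_pts"
    show "0 < orbit_param a z" by (rule orbit_param_works(1)[OF a z])
    show "?H (z, orbit_param a z) = 0" using orbit_param_works(2)[OF a z] by simp
    show "?H (z, r) < ?H (z, s)" if "0 < r" "r < s" for r s
      using orbit_root_sum_strict_mono[OF z _ that(2), of a] that by simp
    let ?r = "orbit_param a z"
    have d: "((\<lambda>r. orbit_root a z r j) has_real_derivative 2 * cross_term z j / orbit_root a z ?r j) (at ?r)"
      "0 < orbit_root a z ?r j" if "j \<in> {1, 2, 4}" for j
    proof -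
      have p: "0 < (gap a j)\<^sup>2 + 4 * ?r * cross_term z j" by (rule arg[OF orbit_param_works(1)[OF a z] that])
      then show "0 < orbit_root a z ?r j" by (simp add: orbit_root_def)
      show "((\<lambda>r. orbit_root a z r j) has_real_derivative 2 * cross_term z j / orbit_root a z ?r j) (at ?r)"
        unfolding orbit_root_def using p by (auto intro!: derivative_eq_intros simp: field_simps)
    qed
    let ?h = "2 * cross_term z 1 / orbit_root a z ?r 1 + 2 * cross_term z 2 / orbit_root a z ?r 2
      + 2 * cross_term z 4 / orbit_root a z ?r 4 - 0"
    have "0 \<le> 2 * cross_term z j / orbit_root a z ?r j" if "j \<in> {1, 2, 4}" for j
      using d(2)[OF that] cross_term_nonneg[of z j] by simp
    from this[of 1] this[of 2] this[of 4]
    have "0 \<le> 2 * cross_term z 1 / orbit_root a z ?r 1" "0 \<le> 2 * cross_term z 2 / orbit_root a z ?r 2"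
      "0 \<le> 2 * cross_term z 4 / orbit_root a z ?r 4" by simp_all
    moreover have "0 < 2 * cross_term z 2 / orbit_root a z ?r 2 \<or> 0 < 2 * cross_term z 1 / orbit_root a z ?r 1"
      using stable_pts_cross_term[OF z] d(2)[of 1] d(2)[of 2] by auto
    ultimately have h0: "0 < ?h" by linarith
    have dh: "((\<lambda>r. ?H (z, r)) has_real_derivative ?h) (at ?r)"
      unfolding fst_conv snd_conv by (intro DERIV_add DERIV_diff DERIV_const d) auto
    show "\<exists>h. h \<noteq> 0 \<and> ((\<lambda>r. ?H (z, r)) has_real_derivative h) (at ?r)"
    proof (intro exI conjI)
      show "?h \<noteq> 0" by (rule less_imp_neq[OF h0, symmetric])
    qed (rule dh)
  qed
qed

lemma upper_pos:
  assumes "third_light a" "z \<in> stable_pts" "j \<in> {1, 2, 4}" shows "0 < upper a z j"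
  using gap_pos[OF assms(1,3)] gap_le_orbit_root[OF assms(1) _ assms(3), of "orbit_param a z" z] orbit_param_works(1)[OF assms(1,2)]
  by (simp add: upper_def)

lemma upper_mult:
  assumes "third_light a" "z \<in> stable_pts" 
  shows "upper a z j * (upper a z j - gap a j) = orbit_param a z * cross_term z j"
proof -
  have "0 \<le> (gap a j)\<^sup>2 + 4 * orbit_param a z * cross_term z j"
    using orbit_param_works(1)[OF assms] cross_term_nonneg[of z j] by (intro add_nonneg_nonneg) auto
  then have "(orbit_root a z (orbit_param a z) j)\<^sup>2 = (gap a j)\<^sup>2 + 4 * orbit_param a z * cross_term z j"
    by (simp add: orbit_root_def)
  then show ?thesis by (simp add: upper_def field_simps power2_eq_square)
qed

lemma upper_sum:
  assumes "third_light a" "z \<in> stable_pts" 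
  shows "upper a z 1 + upper a z 2 + upper a z 4 = 1 - a $ 3"
  using orbit_param_works(2)[OF assms] assms(1) by (simp add: upper_def third_light_def gap_def field_simps)

lemma smooth_on_orbit_proj:
  assumes a: "third_light a"
  shows "smooth_on stable_pts (orbit_proj a)"
proof -
  have nth: "smooth_on stable_pts (\<lambda>z. z $ i)" for i
    by (intro smooth_on_nth smooth_on_id open_stable_pts)
  have cm: "smooth_on stable_pts (\<lambda>z. cmod (z $ i))" if "i \<in> {2, 4}" for i
    by (rule smooth_on_cmod[OF open_stable_pts nth]) (use that in \<open>auto simp: stable_pts_def\<close>)
  have sc: "smooth_on stable_pts (\<lambda>z. orbit_param a z)" using smooth_on_orbit_param[OF a] by simp
  have pl: "smooth_on stable_pts (\<lambda>z. upper a z j)" if j: "j \<in> {1, 2, 4}" for j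
    unfolding upper_def orbit_root_def
  proof (intro smooth_on_divide smooth_on_add smooth_on_const smooth_on_sqrt smooth_on_mult
      open_stable_pts sc smooth_on_subset[OF smooth_on_cross_term])
    show "0 < (gap a j)\<^sup>2 + 4 * orbit_param a z * cross_term z j" if "z \<in> stable_pts" for z
      using gap_pos[OF a j] orbit_param_works(1)[OF a that] cross_term_nonneg[of z j]
      by (intro add_pos_nonneg mult_nonneg_nonneg) auto
  qed auto
  have nz: "upper a z 1 * upper a z 4 \<noteq> 0" "upper a z 2 * upper a z 4 \<noteq> 0" "upper a z 4 \<noteq> 0"
     "cmod (z $ 2) \<noteq> 0" "cmod (z $ 4) \<noteq> 0"
    "0 < upper a z 1 / upper a z 4" "0 < upper a z 2 / upper a z 4"
    "0 < orbit_param a z / (upper a z 1 * upper a z 4)" "0 < orbit_param a z / (upper a z 2 * upper a z 4)"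
    if z: "z \<in> stable_pts" for z
    using upper_pos[OF a z, of 1] upper_pos[OF a z, of 2] upper_pos[OF a z, of 4] orbit_param_works(1)[OF a z] z
    by (auto simp: stable_pts_def)
  show ?thesis
    unfolding orbit_proj_def
    by (intro smooth_on_vec smooth_on_if smooth_on_mult smooth_on_of_real smooth_on_divide smooth_on_sqrt
      nth cm sc pl open_stable_pts) (auto dest: nz)
qed

lemma orbit_proj_nth:
  "orbit_proj a z $ 1 = of_real (cmod (z $ 4) * sqrt (orbit_param a z / (upper a z 2 * upper a z 4))) * z $ 1"
  "orbit_proj a z $ 2 = of_real (sqrt (upper a z 1 / upper a z 4) / cmod (z $ 2)) * z $ 2"
  "orbit_proj a z $ 3 = of_real (cmod (z $ 2) * sqrt (orbit_param a z / (upper a z 1 * upper a z 4))) * z $ 3"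
  "orbit_proj a z $ 4 = of_real (sqrt (upper a z 2 / upper a z 4) / cmod (z $ 4)) * z $ 4"
  by (simp_all add: orbit_proj_def)

lemma orbit_proj_in_stable_pts:
  assumes a: "third_light a" and z: "z \<in> stable_pts"
  shows "orbit_proj a z \<in> stable_pts"
proof -
  note p = upper_pos[OF a z, of 1] upper_pos[OF a z, of 2] upper_pos[OF a z, of 4] orbit_param_works(1)[OF a z]
  have "0 < sqrt (upper a z 1 / upper a z 4)" "0 < sqrt (upper a z 2 / upper a z 4)"
    "0 < sqrt (orbit_param a z / (upper a z 1 * upper a z 4))"
    "0 < sqrt (orbit_param a z / (upper a z 2 * upper a z 4))"
    using p by simp_all
  then show ?thesis using z unfolding stable_pts_def mem_Collect_eq orbit_proj_nth by auto
qed

text \<open>The projection multiplies all these quantities by one positive factor, because it moves points along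
  the orbits; this is what makes a second projection independent of the first one.\<close>

lemma orbit_proj_products:
  assumes a: "third_light a" and z: "z \<in> stable_pts"
  defines "k \<equiv> sqrt (orbit_param a z) / upper a z 4"
  shows "orbit_proj a z $ 1 * of_real (cmod (orbit_proj a z $ 4)) = of_real k * (z $ 1 * of_real (cmod (z $ 4)))"
    "orbit_proj a z $ 3 * of_real (cmod (orbit_proj a z $ 2)) = of_real k * (z $ 3 * of_real (cmod (z $ 2)))"
    "orbit_proj a z $ 1 * orbit_proj a z $ 4 = of_real k * (z $ 1 * z $ 4)"
    "orbit_proj a z $ 2 * orbit_proj a z $ 3 = of_real k * (z $ 2 * z $ 3)"
proof -
  have nz: "z $ 2 \<noteq> 0" "z $ 4 \<noteq> 0" using z by (auto simp: stable_pts_def)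
  note p = upper_pos[OF a z, of 1] upper_pos[OF a z, of 2] upper_pos[OF a z, of 4] orbit_param_works(1)[OF a z]
  have k: "sqrt (orbit_param a z / (upper a z j * upper a z 4)) * sqrt (upper a z j / upper a z 4) = k"
    if "j \<in> {1, 2}" for j
  proof -
    have "0 < upper a z j" using p that by auto
    then have "orbit_param a z / (upper a z j * upper a z 4) * (upper a z j / upper a z 4)
        = orbit_param a z / (upper a z 4)\<^sup>2"
      by (simp add: power2_eq_square)
    then have "sqrt (orbit_param a z / (upper a z j * upper a z 4)) * sqrt (upper a z j / upper a z 4)
        = sqrt (orbit_param a z / (upper a z 4)\<^sup>2)"
      by (simp only: real_sqrt_mult[symmetric])
    then show ?thesis using p by (simp add: real_sqrt_divide k_def)
  qed
  have c4: "cmod (orbit_proj a z $ 4) = sqrt (upper a z 2 / upper a z 4)"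
    and c2: "cmod (orbit_proj a z $ 2) = sqrt (upper a z 1 / upper a z 4)"
    unfolding orbit_proj_nth norm_mult norm_of_real using nz p by simp_all
  show "orbit_proj a z $ 1 * of_real (cmod (orbit_proj a z $ 4)) = of_real k * (z $ 1 * of_real (cmod (z $ 4)))"
    unfolding c4 k[of 2, simplified, symmetric] by (simp add: orbit_proj_nth)
  show "orbit_proj a z $ 3 * of_real (cmod (orbit_proj a z $ 2)) = of_real k * (z $ 3 * of_real (cmod (z $ 2)))"
    unfolding c2 k[of 1, simplified, symmetric] by (simp add: orbit_proj_nth)
  show "orbit_proj a z $ 1 * orbit_proj a z $ 4 = of_real k * (z $ 1 * z $ 4)"
    unfolding k[of 2, simplified, symmetric] orbit_proj_nth using nz by simp
  show "orbit_proj a z $ 2 * orbit_proj a z $ 3 = of_real k * (z $ 2 * z $ 3)"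
    unfolding k[of 1, simplified, symmetric] orbit_proj_nth using nz by simp
qed

text \<open>By construction the squared moduli of the Pluecker coordinates, relative to \<open>P\<^sup>1\<^sup>2 = 1\<close>, are the
  prescribed normalized ones divided by \<open>upper a z 4\<close>; the moment map equations are linear in these.\<close>

lemma orbit_proj_in_coord_fibre:
  assumes a: "third_light a" and z: "z \<in> stable_pts"
  shows "orbit_proj a z \<in> coord_fibre a"
proof -
  have nz: "z $ 2 \<noteq> 0" "z $ 4 \<noteq> 0" using z by (auto simp: stable_pts_def)
  note p = upper_pos[OF a z, of 1] upper_pos[OF a z, of 2] upper_pos[OF a z, of 4] orbit_param_works(1)[OF a z]
  let ?w = "orbit_proj a z" and ?A = "upper a z"
  have ct: "orbit_param a z * (cmod (z $ 4) * cmod (z $ 1))\<^sup>2 = ?A 2 * (?A 2 - gap a 2)"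
    "orbit_param a z * (cmod (z $ 2) * cmod (z $ 3))\<^sup>2 = ?A 1 * (?A 1 - gap a 1)"
    "orbit_param a z * (cmod (z $ 1 * z $ 4 - z $ 2 * z $ 3))\<^sup>2 = ?A 4 * (?A 4 - gap a 4)"
    by (simp_all add: upper_mult[OF a z] cross_term_def norm_mult mult.commute)
  have w4: "(cmod (?w $ 4))\<^sup>2 = ?A 2 / ?A 4" and w2: "(cmod (?w $ 2))\<^sup>2 = ?A 1 / ?A 4"
    unfolding orbit_proj_nth norm_mult norm_of_real using nz p by simp_all
  have "(cmod (?w $ 1))\<^sup>2 = orbit_param a z * (cmod (z $ 4) * cmod (z $ 1))\<^sup>2 / (?A 2 * ?A 4)"
    unfolding orbit_proj_nth norm_mult norm_of_real using p by (simp add: power_mult_distrib)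
  then have w1: "(cmod (?w $ 1))\<^sup>2 = (?A 2 - gap a 2) / ?A 4"
    unfolding ct using p by simp
  have "(cmod (?w $ 3))\<^sup>2 = orbit_param a z * (cmod (z $ 2) * cmod (z $ 3))\<^sup>2 / (?A 1 * ?A 4)"
    unfolding orbit_proj_nth norm_mult norm_of_real using p by (simp add: power_mult_distrib)
  then have w3: "(cmod (?w $ 3))\<^sup>2 = (?A 1 - gap a 1) / ?A 4"
    unfolding ct using p by simp
  have "?w $ 1 * ?w $ 4 - ?w $ 2 * ?w $ 3 = of_real (sqrt (orbit_param a z) / ?A 4) * (z $ 1 * z $ 4 - z $ 2 * z $ 3)"
    unfolding orbit_proj_products[OF a z] by (simp add: algebra_simps)
  then have "(cmod (?w $ 1 * ?w $ 4 - ?w $ 2 * ?w $ 3))\<^sup>2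
      = orbit_param a z * (cmod (z $ 1 * z $ 4 - z $ 2 * z $ 3))\<^sup>2 / (?A 4 * ?A 4)"
    using p by (simp add: norm_mult norm_divide power_mult_distrib power_divide power2_eq_square)
  then have wd: "(cmod (?w $ 1 * ?w $ 4 - ?w $ 2 * ?w $ 3))\<^sup>2 = (?A 4 - gap a 4) / ?A 4"
    unfolding ct using p by simp
  have s: "?A 1 = 1 - a $ 3 - ?A 2 - ?A 4" "a $ 1 = 2 - a $ 2 - a $ 3 - a $ 4"
    using upper_sum[OF a z] a by (auto simp: third_light_def)
  have "weight ?w = (?A 4 + (?A 2 - gap a 2) + ?A 1 + (?A 1 - gap a 1) + ?A 2 + (?A 4 - gap a 4)) / ?A 4"
    unfolding weight_def w1 w2 w3 w4 wd using p by (simp add: field_simps)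
  also have "\<dots> = 1 / ?A 4" using s by (simp add: gap_def)
  finally have wt: "weight ?w = 1 / ?A 4" .
  have "?A 4 + (?A 1 - gap a 1) + ?A 2 = a $ 1" "?A 4 + (?A 2 - gap a 2) + ?A 1 = a $ 2"
    "(?A 2 - gap a 2) + (?A 1 - gap a 1) + (?A 4 - gap a 4) = a $ 3"
    "?A 1 + ?A 2 + (?A 4 - gap a 4) = a $ 4"
    using s by (simp_all add: gap_def)
  note nums = this[symmetric]
  show ?thesis
    unfolding coord_fibre_def mem_Collect_eq wt w1 w2 w3 w4 wd unfolding nums using p
    by (simp add: add_divide_distrib)
qed

text \<open>If \<open>z\<close> is in the fibre, then its own squared moduli divided by \<open>weight z\<close> solve the equations that
  define the projection, with \<open>r = 1 / (weight z)\<^sup>2\<close>.\<close>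

lemma orbit_proj_fixes:
  assumes a: "third_light a" and z: "z \<in> coord_fibre a"
  shows "z \<in> stable_pts" "orbit_proj a z = z"
proof -
  define n where "n = weight z"
  have n: "n \<ge> 1" by (simp add: n_def weight_def)
  have gaps: "n * gap a 4 = 1 - (cmod (z $ 1 * z $ 4 - z $ 2 * z $ 3))\<^sup>2"
    "n * gap a 2 = (cmod (z $ 4))\<^sup>2 - (cmod (z $ 1))\<^sup>2"
    "n * gap a 1 = (cmod (z $ 2))\<^sup>2 - (cmod (z $ 3))\<^sup>2"
  proof -
    have g: "n * gap a j = n - a $ 3 * n - a $ j * n" for j by (simp add: gap_def algebra_simps)
    note e = z[unfolded coord_fibre_def mem_Collect_eq, folded n_def]
    show "n * gap a 4 = 1 - (cmod (z $ 1 * z $ 4 - z $ 2 * z $ 3))\<^sup>2"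
      "n * gap a 2 = (cmod (z $ 4))\<^sup>2 - (cmod (z $ 1))\<^sup>2"
      "n * gap a 1 = (cmod (z $ 2))\<^sup>2 - (cmod (z $ 3))\<^sup>2"
      unfolding g using e n_def[unfolded weight_def] by linarith+
  qed
  have pos: "0 < n * gap a j" if "j \<in> {1, 2, 4}" for j
    using a n that by (auto simp: third_light_def)
  have nz: "z $ 2 \<noteq> 0" "z $ 4 \<noteq> 0" using pos[of 2] pos[of 1] gaps by auto
  have "0 < a $ 3 * n" using a n by (simp add: third_light_def)
  then have "z $ 1 \<noteq> 0 \<or> z $ 3 \<noteq> 0" using z by (auto simp: coord_fibre_def n_def)
  then show S: "z \<in> stable_pts" using nz by (simp add: stable_pts_def)
  \<comment> \<open>The squared modulus of the Pluecker coordinate \<open>P\<^sup>k\<^sup>l\<close> for \<open>{3, j, k, l} = {1, 2, 3, 4}\<close>.\<close>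
  define B where "B = (\<lambda>j::4. if j = 4 then 1 else if j = 2 then (cmod (z $ 4))\<^sup>2 else (cmod (z $ 2))\<^sup>2)"
  have B: "0 \<le> B j" "B j * (B j - n * gap a j) = cross_term z j" if "j \<in> {1, 2, 4}" for j
    using that by (auto simp: B_def gaps cross_term_def norm_mult power_mult_distrib)
  have r: "orbit_root a z (1 / n\<^sup>2) j = (2 * B j - n * gap a j) / n" if j: "j \<in> {1, 2, 4}" for j
  proof -
    have "(gap a j)\<^sup>2 + 4 * (1 / n\<^sup>2) * cross_term z j = ((2 * B j - n * gap a j) / n)\<^sup>2"
      using n by (simp add: B(2)[OF j, symmetric] field_simps power2_eq_square)
    moreover have "0 \<le> 2 * B j - n * gap a j"
      using j gaps by (auto simp: B_def intro: order_trans[OF _ zero_le_power2])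
    ultimately show ?thesis using n by (simp add: orbit_root_def)
  qed
  have "(2 * B 1 - n * gap a 1) + (2 * B 2 - n * gap a 2) + (2 * B 4 - n * gap a 4) = n"
    by (simp add: B_def gaps) (simp add: n_def weight_def)
  then have "orbit_root a z (1 / n\<^sup>2) 1 + orbit_root a z (1 / n\<^sup>2) 2 + orbit_root a z (1 / n\<^sup>2) 4 = 1"
    using n by (simp add: r add_divide_distrib[symmetric])
  then have sc: "orbit_param a z = 1 / n\<^sup>2" using n by (intro orbit_param_unique[OF S]) auto
  have pl: "upper a z j = B j / n" if "j \<in> {1, 2, 4}" for j
    using n by (simp add: upper_def sc r[OF that] field_simps)
  have "orbit_proj a z $ k = z $ k" for k
  proof -
    have "\<forall>k. orbit_proj a z $ k = z $ k"
      unfolding forall_4 orbit_proj_nth sc using n nz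
      by (simp add: pl B_def real_sqrt_divide real_sqrt_mult power2_eq_square)
    then show ?thesis ..
  qed
  then show "orbit_proj a z = z" by (simp add: vec_eq_iff)
qed

text \<open>The hypotheses say that \<open>w\<close> and \<open>z\<close> are on one orbit of the positive torus, in the quantities in which the
  projection is written. Replacing \<open>z\<close> by \<open>w\<close> divides the solution \<open>r\<close> by \<open>k\<^sup>2\<close>.\<close>

lemma orbit_proj_invariant:
  assumes a: "third_light a" and w: "w \<in> stable_pts" and z: "z \<in> stable_pts" and k: "0 < k"
    and e1: "w $ 1 * of_real (cmod (w $ 4)) = of_real k * (z $ 1 * of_real (cmod (z $ 4)))"
    and e3: "w $ 3 * of_real (cmod (w $ 2)) = of_real k * (z $ 3 * of_real (cmod (z $ 2)))"
    and p14: "w $ 1 * w $ 4 = of_real k * (z $ 1 * z $ 4)"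
    and p23: "w $ 2 * w $ 3 = of_real k * (z $ 2 * z $ 3)"
    and s2: "w $ 2 / of_real (cmod (w $ 2)) = z $ 2 / of_real (cmod (z $ 2))"
    and s4: "w $ 4 / of_real (cmod (w $ 4)) = z $ 4 / of_real (cmod (z $ 4))"
  shows "orbit_proj a w = orbit_proj a z"
proof -
  have d: "w $ 1 * w $ 4 - w $ 2 * w $ 3 = of_real k * (z $ 1 * z $ 4 - z $ 2 * z $ 3)"
    unfolding p14 p23 by (simp add: algebra_simps)
  have ct: "cross_term w j = k\<^sup>2 * cross_term z j" for j
  proof -
    have "(cmod (of_real k * u))\<^sup>2 = k\<^sup>2 * (cmod u)\<^sup>2" for u
      by (simp add: norm_mult power_mult_distrib)
    then show ?thesis unfolding cross_term_def d unfolding p14 p23 by (auto simp only: split: if_split)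
  qed
  have rt: "orbit_root a w r j = orbit_root a z (r * k\<^sup>2) j" for r j
    by (simp add: orbit_root_def ct mult_ac)
  have pm: "orbit_param a w = orbit_param a z / k\<^sup>2"
  proof (rule orbit_param_unique[OF w])
    show "0 < orbit_param a z / k\<^sup>2" using orbit_param_works(1)[OF a z] k by simp
    show "orbit_root a w (orbit_param a z / k\<^sup>2) 1 + orbit_root a w (orbit_param a z / k\<^sup>2) 2
        + orbit_root a w (orbit_param a z / k\<^sup>2) 4 = 1"
      unfolding rt using orbit_param_works(2)[OF a z] k by simp
  qed
  have up: "upper a w j = upper a z j" for j
    unfolding upper_def rt pm using k by simp
  have sq: "sqrt (orbit_param a w / c) = sqrt (orbit_param a z / c) / k" for c
    unfolding pm using k by (simp add: real_sqrt_divide real_sqrt_mult)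
  have "\<forall>i. orbit_proj a w $ i = orbit_proj a z $ i"
    unfolding forall_4
  proof (intro conjI)
    have "orbit_proj a w $ 1
        = of_real (sqrt (orbit_param a w / (upper a w 2 * upper a w 4))) * (w $ 1 * of_real (cmod (w $ 4)))"
      by (simp add: orbit_proj_nth)
    also have "\<dots> = orbit_proj a z $ 1"
      unfolding e1 sq up using k by (simp add: orbit_proj_nth)
    finally show "orbit_proj a w $ 1 = orbit_proj a z $ 1" .
    have "orbit_proj a w $ 3
        = of_real (sqrt (orbit_param a w / (upper a w 1 * upper a w 4))) * (w $ 3 * of_real (cmod (w $ 2)))"
      by (simp add: orbit_proj_nth)
    also have "\<dots> = orbit_proj a z $ 3"
      unfolding e3 sq up using k by (simp add: orbit_proj_nth)
    finally show "orbit_proj a w $ 3 = orbit_proj a z $ 3" .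
    have "orbit_proj a w $ 2
        = of_real (sqrt (upper a w 1 / upper a w 4)) * (w $ 2 / of_real (cmod (w $ 2)))"
      by (simp add: orbit_proj_nth)
    also have "\<dots> = orbit_proj a z $ 2"
      unfolding s2 up by (simp add: orbit_proj_nth)
    finally show "orbit_proj a w $ 2 = orbit_proj a z $ 2" .
    have "orbit_proj a w $ 4
        = of_real (sqrt (upper a w 2 / upper a w 4)) * (w $ 4 / of_real (cmod (w $ 4)))"
      by (simp add: orbit_proj_nth)
    also have "\<dots> = orbit_proj a z $ 4"
      unfolding s4 up by (simp add: orbit_proj_nth)
    finally show "orbit_proj a w $ 4 = orbit_proj a z $ 4" .
  qed
  then show ?thesis by (simp add: vec_eq_iff)
qed

lemma orbit_proj_orbit_proj:
  assumes a: "third_light a" and b: "third_light b" and z: "z \<in> stable_pts"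
  shows "orbit_proj a (orbit_proj b z) = orbit_proj a z"
proof (rule orbit_proj_invariant[OF a orbit_proj_in_stable_pts[OF b z] z _ orbit_proj_products[OF b z]])
  note p = upper_pos[OF b z, of 1] upper_pos[OF b z, of 2] upper_pos[OF b z, of 4]
    orbit_param_works(1)[OF b z]
  show "0 < sqrt (orbit_param b z) / upper b z 4" using p by simp
  have *: "of_real t * u / of_real (cmod (of_real t * u)) = u / of_real (cmod u)"
    if "0 < t" for t :: real and u :: complex
    using that by (simp add: norm_mult)
  have nz: "z $ 2 \<noteq> 0" "z $ 4 \<noteq> 0" using z by (auto simp: stable_pts_def)
  show "orbit_proj b z $ 2 / of_real (cmod (orbit_proj b z $ 2)) = z $ 2 / of_real (cmod (z $ 2))"
    unfolding orbit_proj_nth(2) by (rule *) (use p nz in simp)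
  show "orbit_proj b z $ 4 / of_real (cmod (orbit_proj b z $ 4)) = z $ 4 / of_real (cmod (z $ 4))"
    unfolding orbit_proj_nth(4) by (rule *) (use p nz in simp)
qed


section \<open>The moment map in an affine chart\<close>

lemma sum_pairs_bij:
  fixes h :: "4 \<Rightarrow> 4 \<Rightarrow> real" and \<sigma> :: "4 \<Rightarrow> 4"
  assumes \<sigma>: "bij \<sigma>" and sym: "\<And>i j. h i j = h j i"
  shows "(\<Sum>(i, j)\<in>{(i, j). i < j}. h i j) =
    h (\<sigma> 1) (\<sigma> 2) + h (\<sigma> 1) (\<sigma> 3) + h (\<sigma> 1) (\<sigma> 4) + h (\<sigma> 2) (\<sigma> 3) + h (\<sigma> 2) (\<sigma> 4) + h (\<sigma> 3) (\<sigma> 4)"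
proof -
  define g where "g = (\<lambda>i j. if i = j then 0 else h i j)"
  have "(\<Sum>i\<in>UNIV. \<Sum>j\<in>UNIV. g (\<sigma> i) (\<sigma> j)) = (\<Sum>i\<in>UNIV. \<Sum>j\<in>UNIV. g i j)"
    using sum.reindex_bij_betw[OF \<sigma>] by (simp add: sum.reindex_bij_betw[OF \<sigma>, of "\<lambda>j. g _ j"])
  then show ?thesis
    unfolding sum_less_4[of h, OF sym] using bij_4_neq[OF \<sigma>]
    by (simp add: sum_4 g_def sym[of 2 1] sym[of 3 1] sym[of 3 2] sym[of 4 1] sym[of 4 2] sym[of 4 3]
        sym[of "\<sigma> 2" "\<sigma> 1"] sym[of "\<sigma> 3" "\<sigma> 1"] sym[of "\<sigma> 3" "\<sigma> 2"]
        sym[of "\<sigma> 4" "\<sigma> 1"] sym[of "\<sigma> 4" "\<sigma> 2"] sym[of "\<sigma> 4" "\<sigma> 3"])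
qed

lemma moment_map_nth:
  fixes f :: "(complex^4) \<times> (complex^4)" and \<sigma> :: "4 \<Rightarrow> 4"
  assumes \<sigma>: "bij \<sigma>" and F: "is_frame L f"
  defines "m \<equiv> \<lambda>i j. (cmod (minor f (\<sigma> i) (\<sigma> j)))\<^sup>2"
  defines "N \<equiv> m 1 2 + m 1 3 + m 1 4 + m 2 3 + m 2 4 + m 3 4"
  shows "moment_map L $ \<sigma> 1 = (m 1 2 + m 1 3 + m 1 4) / N"
    "moment_map L $ \<sigma> 2 = (m 1 2 + m 2 3 + m 2 4) / N"
    "moment_map L $ \<sigma> 3 = (m 1 3 + m 2 3 + m 3 4) / N"
    "moment_map L $ \<sigma> 4 = (m 1 4 + m 2 4 + m 3 4) / N"
proof -
  have sym: "cmod (minor f i j) = cmod (minor f j i)" for i j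
    by (cases f) (simp add: minor_def norm_minus_commute mult.commute)
  have symL: "Lambda i j = Lambda j i" for i j by (simp add: Lambda_def)
  have L: "moment_map L $ l = (\<Sum>(i, j)\<in>{(i, j). i < j}. (cmod (minor f i j))\<^sup>2 * Lambda i j $ l) / N" for l
    unfolding moment_map_frame[OF F] N_def m_def
    by (subst sum_pairs_bij[OF \<sigma>, symmetric])
      (simp_all add: sym[of _ i for i] case_prod_unfold divide_inverse_commute)
  have "moment_map L $ l = (m 1 2 * Lambda (\<sigma> 1) (\<sigma> 2) $ l + m 1 3 * Lambda (\<sigma> 1) (\<sigma> 3) $ l
      + m 1 4 * Lambda (\<sigma> 1) (\<sigma> 4) $ l + m 2 3 * Lambda (\<sigma> 2) (\<sigma> 3) $ l
      + m 2 4 * Lambda (\<sigma> 2) (\<sigma> 4) $ l + m 3 4 * Lambda (\<sigma> 3) (\<sigma> 4) $ l) / N" for l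
    unfolding L by (subst sum_pairs_bij[OF \<sigma>]) (simp_all add: m_def, metis sym symL)
  then show "moment_map L $ \<sigma> 1 = (m 1 2 + m 1 3 + m 1 4) / N"
    "moment_map L $ \<sigma> 2 = (m 1 2 + m 2 3 + m 2 4) / N"
    "moment_map L $ \<sigma> 3 = (m 1 3 + m 2 3 + m 3 4) / N"
    "moment_map L $ \<sigma> 4 = (m 1 4 + m 2 4 + m 3 4) / N"
    using bij_4_neq[OF \<sigma>] by (simp_all add: Lambda_def axis_def)
qed

text \<open>A plane outside of the chart has \<open>P\<^sup>1\<^sup>2 = 0\<close> (in positions of the chart), and then the first two
  coordinates of its moment add up to at most \<open>1\<close>.\<close>

lemma moment_fibre_in_chart:
  assumes \<sigma>: "bij \<sigma>" and x: "1 < x $ \<sigma> 1 + x $ \<sigma> 2"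
  shows "moment_fibre x = param \<sigma> ` coord_fibre (\<chi> k. x $ \<sigma> k)"
proof -
  have "L \<in> range (param \<sigma>)" if "L \<in> moment_fibre x" for L
  proof -
    have L: "L \<in> Gr42" "moment_map L = x" using that by (auto simp: moment_fibre_def)
    obtain f where F: "is_frame L f" using is_frame_exists[OF L(1)] by blast
    have "minor f (\<sigma> 1) (\<sigma> 2) \<noteq> 0"
    proof
      assume z: "minor f (\<sigma> 1) (\<sigma> 2) = 0"
      define t where "t = (cmod (minor f (\<sigma> 1) (\<sigma> 3)))\<^sup>2 + (cmod (minor f (\<sigma> 1) (\<sigma> 4)))\<^sup>2
        + (cmod (minor f (\<sigma> 2) (\<sigma> 3)))\<^sup>2 + (cmod (minor f (\<sigma> 2) (\<sigma> 4)))\<^sup>2"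
      have "x $ \<sigma> 1 + x $ \<sigma> 2 = t / (t + (cmod (minor f (\<sigma> 3) (\<sigma> 4)))\<^sup>2)"
        using moment_map_nth(1,2)[OF \<sigma> F] unfolding L(2) z
        by (simp add: t_def add_divide_distrib[symmetric] algebra_simps)
      also have "\<dots> \<le> 1" by (simp add: divide_le_eq_1 t_def add_nonneg_pos less_le)
      finally show False using x by simp
    qed
    then show ?thesis using range_param_iff[OF \<sigma> F] by blast
  qed
  moreover have "param \<sigma> z \<in> moment_fibre x \<longleftrightarrow> z \<in> coord_fibre (\<chi> k. x $ \<sigma> k)" for z
  proof -
    obtain a b where ab: "graph_frame \<sigma> z = (a, b)" by force
    have m: "minor (graph_frame \<sigma> z) (\<sigma> 1) (\<sigma> 2) = 1"
      "minor (graph_frame \<sigma> z) (\<sigma> 1) (\<sigma> 3) = z $ 3" "minor (graph_frame \<sigma> z) (\<sigma> 1) (\<sigma> 4) = z $ 4"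
      "minor (graph_frame \<sigma> z) (\<sigma> 2) (\<sigma> 3) = - z $ 1" "minor (graph_frame \<sigma> z) (\<sigma> 2) (\<sigma> 4) = - z $ 2"
      "minor (graph_frame \<sigma> z) (\<sigma> 3) (\<sigma> 4) = z $ 1 * z $ 4 - z $ 2 * z $ 3"
      unfolding ab by (simp_all add: minor_def graph_frame_nth[OF \<sigma> ab])
    note mm = moment_map_nth[OF \<sigma> is_frame_graph_frame[OF \<sigma>, of z], unfolded m]
    have w: "1 + (cmod (z $ 3))\<^sup>2 + (cmod (z $ 4))\<^sup>2 + (cmod (- z $ 1))\<^sup>2 + (cmod (- z $ 2))\<^sup>2
       + (cmod (z $ 1 * z $ 4 - z $ 2 * z $ 3))\<^sup>2 = weight z" "0 < weight z"
      by (simp_all add: weight_def add_pos_nonneg)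
    have "param \<sigma> z \<in> moment_fibre x \<longleftrightarrow> moment_map (param \<sigma> z) = x"
      using param_in_Gr42[OF \<sigma>] by (simp add: moment_fibre_def)
    also have "\<dots> \<longleftrightarrow> z \<in> coord_fibre (\<chi> k. x $ \<sigma> k)"
      unfolding vec_eq_iff bij_4_all[OF \<sigma>] mm norm_one power_one w(1) using w(2)
      by (simp add: coord_fibre_def divide_eq_eq add.commute)
    finally show ?thesis .
  qed
  ultimately show ?thesis by blast
qed

text \<open>Up to a sign, transposing the matrix of a linear map gives the chart coordinates of the annihilator
  of its graph, in the chart with the complementary positions first. Passing to the annihilator replaces
  a value \<open>x\<close> of the moment map by \<open>1 - x\<close>, and the sign can be dropped because it does not affect any
  modulus.\<close>

definition swap :: "complex^4 \<Rightarrow> complex^4" where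
  "swap z = (\<chi> k. if k = 2 then z $ 3 else if k = 3 then z $ 2 else z $ k)"

lemma swap_nth: "swap z $ 1 = z $ 1" "swap z $ 2 = z $ 3" "swap z $ 3 = z $ 2" "swap z $ 4 = z $ 4"
  by (simp_all add: swap_def)

lemma swap_swap: "swap (swap z) = z"
  by (simp add: vec_eq_iff swap_def)

lemma bounded_linear_swap: "bounded_linear swap"
  by (intro linear_conv_bounded_linear[THEN iffD1] linearI) (simp_all add: vec_eq_iff swap_def)

lemma coord_fibre_swap:
  assumes "b $ 1 = 1 - a $ 3" "b $ 2 = 1 - a $ 4" "b $ 3 = 1 - a $ 1" "b $ 4 = 1 - a $ 2"
  shows "coord_fibre a = swap ` coord_fibre b"
proof -
  have w: "weight (swap z) = weight z" for z
    by (simp add: weight_def swap_nth mult.commute)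
  have *: "swap z \<in> coord_fibre b \<longleftrightarrow> z \<in> coord_fibre a" for z
    unfolding coord_fibre_def mem_Collect_eq w swap_nth assms mult.commute[of "z $ 3" "z $ 2"]
    unfolding left_diff_distrib mult_1 using weight_def[of z] by linarith
  show ?thesis
  proof (intro equalityI subsetI)
    fix z assume "z \<in> coord_fibre a"
    then have "swap z \<in> coord_fibre b" using * by blast
    then show "z \<in> swap ` coord_fibre b" by (rule image_eqI[rotated]) (simp add: swap_swap)
  qed (auto simp: swap_swap *[symmetric])
qed


section \<open>Chambers and their symmetries\<close>

lemma hypersimplex_vertices:
  assumes "i \<noteq> j" shows "axis i 1 + axis j 1 \<in> hypersimplex"
  using assms by (auto simp: hypersimplex_def axis_def sum.distrib)

text \<open>A point of the relative interior stays in the hypersimplex when it is moved a little away from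
  any vertex. Vertices with \<open>i\<close>-th coordinate \<open>1\<close> and \<open>0\<close> give the two bounds.\<close>

lemma rel_interior_hypersimplex:
  assumes x: "x \<in> rel_interior hypersimplex"
  shows "0 < x $ i" "x $ i < 1" "x $ 1 + x $ 2 + x $ 3 + x $ 4 = 2"
proof -
  have cv: "convex hypersimplex"
    unfolding convex_def hypersimplex_def
    by (auto simp: sum.distrib sum_distrib_left[symmetric] convex_bound_le
        simp flip: distrib_right)
  have xh: "x \<in> hypersimplex" using x rel_interior_subset by blast
  then show "x $ 1 + x $ 2 + x $ 3 + x $ 4 = 2" by (simp add: hypersimplex_def sum_4)
  have e: "\<exists>e>1. (1 - e) *\<^sub>R y + e *\<^sub>R x \<in> hypersimplex" if "y \<in> hypersimplex" for y
    using convex_rel_interior_if2[OF cv x] hull_subset[of hypersimplex affine] that by blast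
  define j k :: 4 where "j = (if i = 1 then 2 else 1)" and "k = (if i = 4 then 3 else 4)"
  then have d: "j \<noteq> i" "k \<noteq> i" "j \<noteq> k" by auto
  show "0 < x $ i"
  proof (rule ccontr)
    assume "\<not> 0 < x $ i"
    then have 0: "x $ i = 0" using xh by (simp add: hypersimplex_def order_antisym)
    obtain e where e: "e > 1" "(1 - e) *\<^sub>R (axis i 1 + axis j 1) + e *\<^sub>R x \<in> hypersimplex"
      using e[OF hypersimplex_vertices[of i j]] d by blast
    then have "0 \<le> ((1 - e) *\<^sub>R (axis i 1 + axis j 1) + e *\<^sub>R x) $ i" unfolding hypersimplex_def by blast
    then show False using e(1) 0 d by (simp add: axis_def)
  qed
  show "x $ i < 1"
  proof (rule ccontr)
    assume "\<not> x $ i < 1"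
    then have 1: "x $ i = 1" using xh by (simp add: hypersimplex_def order_antisym)
    obtain e where e: "e > 1" "(1 - e) *\<^sub>R (axis j 1 + axis k 1) + e *\<^sub>R x \<in> hypersimplex"
      using e[OF hypersimplex_vertices[of j k]] d by blast
    then have "((1 - e) *\<^sub>R (axis j 1 + axis k 1) + e *\<^sub>R x) $ i \<le> 1" unfolding hypersimplex_def by blast
    then show False using e(1) 1 d by (simp add: axis_def)
  qed
qed

text \<open>The pairs of complementary sums \<open>x $ i + x $ j\<close> and \<open>x $ k + x $ l\<close> lie on opposite sides of \<open>1\<close>, so the
  three signs that describe a chamber single out an index that is on the same side with all others.\<close>

lemma light_or_heavy_index:
  fixes x :: "real^4"
  assumes "x $ 1 + x $ 2 + x $ 3 + x $ 4 = 2" "x $ 1 + x $ 2 \<noteq> 1" "x $ 1 + x $ 3 \<noteq> 1" "x $ 1 + x $ 4 \<noteq> 1"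
  shows "\<exists>k. (\<forall>j. j \<noteq> k \<longrightarrow> x $ k + x $ j < 1) \<or> (\<forall>j. j \<noteq> k \<longrightarrow> 1 < x $ k + x $ j)"
proof -
  have others: "(\<forall>j. j \<noteq> 1 \<longrightarrow> P j) \<longleftrightarrow> P 2 \<and> P 3 \<and> P 4" "(\<forall>j. j \<noteq> 2 \<longrightarrow> P j) \<longleftrightarrow> P 1 \<and> P 3 \<and> P 4"
    "(\<forall>j. j \<noteq> 3 \<longrightarrow> P j) \<longleftrightarrow> P 1 \<and> P 2 \<and> P 4" "(\<forall>j. j \<noteq> 4 \<longrightarrow> P j) \<longleftrightarrow> P 1 \<and> P 2 \<and> P (3::4)" for P
    by (simp_all add: forall_4)
  show ?thesis
  proof (cases "x $ 1 + x $ 2 < 1"; cases "x $ 1 + x $ 3 < 1"; cases "x $ 1 + x $ 4 < 1")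
    assume "x $ 1 + x $ 2 < 1" "x $ 1 + x $ 3 < 1" "x $ 1 + x $ 4 < 1"
    then show ?thesis by (intro exI[of _ 1] disjI1) (unfold others, intro conjI; linarith)
  next
    assume "x $ 1 + x $ 2 < 1" "x $ 1 + x $ 3 < 1" "\<not> x $ 1 + x $ 4 < 1"
    with assms show ?thesis by (intro exI[of _ 4] disjI2) (unfold others, intro conjI; linarith)
  next
    assume "x $ 1 + x $ 2 < 1" "\<not> x $ 1 + x $ 3 < 1" "x $ 1 + x $ 4 < 1"
    with assms show ?thesis by (intro exI[of _ 3] disjI2) (unfold others, intro conjI; linarith)
  next
    assume "x $ 1 + x $ 2 < 1" "\<not> x $ 1 + x $ 3 < 1" "\<not> x $ 1 + x $ 4 < 1"
    with assms show ?thesis by (intro exI[of _ 2] disjI1) (unfold others, intro conjI; linarith)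
  next
    assume "\<not> x $ 1 + x $ 2 < 1" "x $ 1 + x $ 3 < 1" "x $ 1 + x $ 4 < 1"
    with assms show ?thesis by (intro exI[of _ 2] disjI2) (unfold others, intro conjI; linarith)
  next
    assume "\<not> x $ 1 + x $ 2 < 1" "x $ 1 + x $ 3 < 1" "\<not> x $ 1 + x $ 4 < 1"
    with assms show ?thesis by (intro exI[of _ 3] disjI1) (unfold others, intro conjI; linarith)
  next
    assume "\<not> x $ 1 + x $ 2 < 1" "\<not> x $ 1 + x $ 3 < 1" "x $ 1 + x $ 4 < 1"
    with assms show ?thesis by (intro exI[of _ 4] disjI1) (unfold others, intro conjI; linarith)
  next
    assume "\<not> x $ 1 + x $ 2 < 1" "\<not> x $ 1 + x $ 3 < 1" "\<not> x $ 1 + x $ 4 < 1"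
    with assms show ?thesis by (intro exI[of _ 1] disjI2) (unfold others, intro conjI; linarith)
  qed
qed

text \<open>Duality is applied exactly if the distinguished index is heavy; the flag records this.\<close>

definition twist :: "bool \<Rightarrow> complex^4 \<Rightarrow> complex^4" where
  "twist h z = (if h then swap z else z)"

lemma twist_twist: "twist h (twist h z) = z"
  by (simp add: twist_def swap_swap)

lemma bounded_linear_twist: "bounded_linear (twist h)"
  by (cases h) (simp_all add: twist_def[abs_def] bounded_linear_swap bounded_linear_ident)

text \<open>Relabelling and duality bring every fibre into the form of a fibre with a small third coordinate.\<close>

lemma moment_fibre_normal_form:
  assumes "C \<in> max_chambers" "x \<in> C"
  obtains \<sigma> h a where "bij \<sigma>" "third_light a" "moment_fibre x = param \<sigma> ` twist h ` coord_fibre a"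
proof -
  have "x \<in> rel_interior hypersimplex" and ne: "x $ 1 + x $ 2 \<noteq> 1" "x $ 1 + x $ 3 \<noteq> 1" "x $ 1 + x $ 4 \<noteq> 1"
    using in_components_subset[OF assms(1)[unfolded max_chambers_def]] assms(2) by auto
  note x = rel_interior_hypersimplex[OF this(1)]
  have sum: "x $ \<sigma> 1 + x $ \<sigma> 2 + x $ \<sigma> 3 + x $ \<sigma> 4 = 2" if "bij \<sigma>" for \<sigma> :: "4 \<Rightarrow> 4"
    using sum.reindex_bij_betw[OF that, of "\<lambda>i. x $ i"] x(3) by (simp add: sum_4)
  obtain k where "(\<forall>j. j \<noteq> k \<longrightarrow> x $ k + x $ j < 1) \<or> (\<forall>j. j \<noteq> k \<longrightarrow> 1 < x $ k + x $ j)"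
    using light_or_heavy_index[OF x(3) ne] by blast
  then show ?thesis
  proof
    assume l: "\<forall>j. j \<noteq> k \<longrightarrow> x $ k + x $ j < 1"
    \<comment> \<open>A light index goes to position \<open>3\<close>, as \<^const>\<open>third_light\<close> demands.\<close>
    define \<sigma> where "\<sigma> = Transposition.transpose 3 k"
    have \<sigma>: "bij \<sigma>" "\<sigma> 3 = k" by (auto simp: \<sigma>_def)
    note d = bij_4_distinct[OF \<sigma>(1)]
    have l': "x $ k + x $ \<sigma> 1 < 1" "x $ k + x $ \<sigma> 2 < 1" "x $ k + x $ \<sigma> 4 < 1"
      using l d \<sigma>(2) by auto
    have "third_light (\<chi> k. x $ \<sigma> k)"
      using sum[OF \<sigma>(1)] l' x(1)[of k] \<sigma>(2) by (simp add: third_light_def gap_def)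
    moreover have "1 < x $ \<sigma> 1 + x $ \<sigma> 2" using sum[OF \<sigma>(1)] l' \<sigma>(2) by simp
    from moment_fibre_in_chart[OF \<sigma>(1) this]
    have "moment_fibre x = param \<sigma> ` twist False ` coord_fibre (\<chi> k. x $ \<sigma> k)"
      by (simp add: twist_def)
    ultimately show ?thesis using that[OF \<sigma>(1)] by blast
  next
    assume l: "\<forall>j. j \<noteq> k \<longrightarrow> 1 < x $ k + x $ j"
    \<comment> \<open>A heavy index goes to position \<open>1\<close>, which duality exchanges with position \<open>3\<close>.\<close>
    define \<sigma> where "\<sigma> = Transposition.transpose 1 k"
    have \<sigma>: "bij \<sigma>" "\<sigma> 1 = k" by (auto simp: \<sigma>_def)
    note d = bij_4_distinct[OF \<sigma>(1)]
    have l': "1 < x $ k + x $ \<sigma> 2" "1 < x $ k + x $ \<sigma> 3" "1 < x $ k + x $ \<sigma> 4"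
      using l d \<sigma>(2) by auto
    define b :: "real^4" where "b = (\<chi> i. 1 - x $ \<sigma> (if i = 1 then 3 else if i = 2 then 4 else if i = 3 then 1 else 2))"
    have b: "b $ 1 = 1 - x $ \<sigma> 3" "b $ 2 = 1 - x $ \<sigma> 4" "b $ 3 = 1 - x $ \<sigma> 1" "b $ 4 = 1 - x $ \<sigma> 2"
      by (simp_all add: b_def)
    have "third_light b"
      using sum[OF \<sigma>(1)] l' x(2)[of k] \<sigma>(2) by (simp add: third_light_def gap_def b)
    moreover have "coord_fibre (\<chi> k. x $ \<sigma> k) = twist True ` coord_fibre b"
      using coord_fibre_swap[of b "\<chi> k. x $ \<sigma> k"] by (simp add: b twist_def)
    then have "moment_fibre x = param \<sigma> ` twist True ` coord_fibre b"
      using moment_fibre_in_chart[OF \<sigma>(1), of x] l' \<sigma>(2) by simp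
    ultimately show ?thesis using that[OF \<sigma>(1)] by blast
  qed
qed

theorem corollary3:
  fixes x y :: "real^4" and C D :: "(real^4) set"
  assumes "C \<in> max_chambers" and "x \<in> C"
    and "D \<in> max_chambers" and "y \<in> D"
  shows "diffeomorphic (moment_fibre x) (moment_fibre y)"
proof -
  obtain \<sigma> h a where x: "bij \<sigma>" "third_light a" "moment_fibre x = param \<sigma> ` twist h ` coord_fibre a"
    using moment_fibre_normal_form[OF assms(1,2)] .
  obtain \<tau> k b where y: "bij \<tau>" "third_light b" "moment_fibre y = param \<tau> ` twist k ` coord_fibre b"
    using moment_fibre_normal_form[OF assms(3,4)] .
  have op: "open (twist h -` stable_pts)" for h
    by (rule open_vimage[OF open_stable_pts linear_continuous_on[OF bounded_linear_twist]])
  have sm: "smooth_on (twist h -` stable_pts) (\<lambda>z. twist k (orbit_proj a (twist h z)))"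
    if "third_light a" for h k a
    by (intro smooth_on_linear[OF op bounded_linear_twist]
        smooth_on_compose[OF op open_stable_pts _ _ smooth_on_orbit_proj[OF that]] smooth_on_id) auto
  have sub: "twist h ` coord_fibre a \<subseteq> twist h -` stable_pts" if "third_light a" for h a
    using orbit_proj_fixes(1)[OF that] by (auto simp: twist_twist)
  have inv: "orbit_proj a (orbit_proj b z) = z"
    if "third_light a" "third_light b" "z \<in> coord_fibre a" for a b z
    using orbit_proj_orbit_proj[OF that(1,2)] orbit_proj_fixes[OF that(1,3)] by simp
  have into: "orbit_proj b z \<in> coord_fibre b" if "third_light a" "third_light b" "z \<in> coord_fibre a" for a b z
    by (rule orbit_proj_in_coord_fibre[OF that(2) orbit_proj_fixes(1)[OF that(1,3)]])
  show ?thesis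
    unfolding x(3) y(3)
    by (rule diffeomorphic_charts[OF x(1) y(1) op op sub[OF x(2)] sub[OF y(2)] sm[OF y(2), of h k] sm[OF x(2), of k h]])
      (auto simp: twist_twist inv into x(2) y(2) intro: into[OF x(2) y(2)] into[OF y(2) x(2)])
qed

end
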